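(* Let $(\boldsymbol{\sigma}_h,\boldsymbol{u}_h)\in S_h^g\times V_h$ be the solution of the discrete mixed problem. Let $\widetilde{\boldsymbol{u}}_h\in V_h^{l}$ be defined by the following equations on each $K\in\mathcal{T}_h$: $$(\varepsilon(\widetilde{\boldsymbol{u}}_h),\varepsilon(\boldsymbol{v}_K))_K=(\mathcal{C}\boldsymbol{\sigma}_h,\varepsilon(\boldsymbol{v}_K))_K\quad\forall \boldsymbol{v}_K\in (I-P_h)V_h^{l}|_K,$$ $$(\widetilde{\boldsymbol{u}}_h,\boldsymbol{v}_K)_K=(\boldsymbol{u}_h,\boldsymbol{v}_K)_K\quad\forall \boldsymbol{v}_K\in P_hV_h^{l}|_K.$$ Let $\boldsymbol{w}_h\in V_h^{l}$ solve the local residual minimization problem: for each $K\in\mathcal{T}_h$, $\boldsymbol{w}_h|_K$ minimizes $$\boldsymbol{v}\mapsto\tfrac12\|\mathcal{C}\boldsymbol{\sigma}_h-\varepsilon(\boldsymbol{v})\|_{*,K}^2$$ over all $\boldsymbol{v}\in V^{l}(K)$ satisfying $(\boldsymbol{v},\boldsymbol{v}_K)_K=(\boldsymbol{u}_h,\boldsymbol{v}_K)_K$ for all $\boldsymbol{v}_K\in P_hV_h^{l}|_K$, where $$\|\boldsymbol{\tau}\|_{*,K}:=\sup_{\boldsymbol{0}\neq \boldsymbol{v}_K\in (I-P_h)V_h^{l+1}|_K}\frac{(\boldsymbol{\tau},\varepsilon(\boldsymbol{v}_K))_K}{\|\varepsilon(\boldsymbol{v}_K)\|_K}.$$ Then 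$\boldsymbol{w}_h=\widetilde{\boldsymbol{u}}_h$.
   Context: Let $d\in\{2,3\}$ and let $\Omega\subset\mathbb{R}^d$ be a polygonal/polyhedral domain with boundary $\Gamma$ split into disjoint parts $\Gamma_D,\Gamma_N$, $|\Gamma_D|>0$. $(\cdot,\cdot)_K$ and $\|\cdot\|_K$ are the $L^2(K)$ inner product and norm (no subscript: over $\Omega$). $\varepsilon(\boldsymbol{v})=\frac12(\nabla\boldsymbol{v}+(\nabla\boldsymbol{v})^{T})$. With Lamé parameters $\mu,\lambda>0$, the compliance tensor is $\mathcal{C}\boldsymbol{\tau}=\frac1{2\mu}\big(\boldsymbol{\tau}-\frac{\lambda}{2\mu+d\lambda}\mathrm{tr}(\boldsymbol{\tau})I\big)$. $H(\mathrm{div};\Omega)$ is the space of symmetric $L^2$ matrix fields with row-wise divergence in $L^2$. The data are a load $\boldsymbol{f}$ and a traction $\boldsymbol{g}$ on $\Gamma_N$. Mesh and discrete spaces. $\mathcal{T}_h$ is a triangular/tetrahedral mesh of $\Omega$. One of the following exactly symmetric mixed element families is fixed: Arnold–Douglas–Gupta (ADG, triangles, 1984), Guzmán–Neilan (GN, triangles, 2014), Arnold–Awanou–Winther (AAW, tetrahedra, 2008), each of degree $k\ge2$, or the linear Johnson–Mercier method (JM, triangles, 1978). $V_h$ is the space of $\boldsymbol{v}\in[L^2(\Omega)]^d$ with $\boldsymbol{v}|_K\in V(K)$ for all $K\in\mathcal{T}_h$, where $V(K)=[P_{k-1}(K)]^d$ for ADG, GN, AAW and $V(K)=[P_1(K)]^d$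 for JM. $S_h$ is the space of $\boldsymbol{\tau}\in H(\mathrm{div};\Omega)$ with $\boldsymbol{\tau}|_K\in S(K)$ for all $K$, where $S(K)$ is the local space of symmetric matrix fields of the chosen family. For ADG, GN, AAW one has $[P_k(K)]^{d\times d}_{\mathrm{sym}}\subset S(K)$, local degrees of freedom $\int_K\boldsymbol{\tau}:\varepsilon(\boldsymbol{v})$, $\boldsymbol{v}\in[P_{k-1}(K)]^d$, and $\int_E\boldsymbol{\tau}\boldsymbol{n}\cdot\boldsymbol{v}$, $\boldsymbol{v}\in[P_k(E)]^d$, for each edge/face $E$ of $K$, and $\mathrm{div}\,S_h\subset V_h$. For JM, $S(K)$ consists of the symmetric, $H(\mathrm{div})$-conforming, piecewise linear fields on the Alfeld (barycentric) split of $K$. For edges/faces $E\subset\Gamma_N$, $Q_h|_E$ is the $L^2(E)$-projection onto $[P_k(E)]^d$ ($[P_1(E)]^d$ for JM). $S_h^g=\{\boldsymbol{\tau}\in S_h:\boldsymbol{\tau}\boldsymbol{n}=Q_h\boldsymbol{g}\text{ on }\Gamma_N\}$, $S_h^0=\{\boldsymbol{\tau}\in S_h:\boldsymbol{\tau}\boldsymbol{n}=\boldsymbol{0}\text{ on }\Gamma_N\}$. The discrete mixed problem (uniquely solvable) is: find $(\boldsymbol{\sigma}_h,\boldsymbol{u}_h)\in S_h^g\times V_h$ with $$(\mathcal{C}\boldsymbol{\sigma}_h,\boldsymbol{\tau})+(\boldsymbol{u}_h,\mathrm{div}\,\boldsymbol{\tau})+(\boldsymbol{v},\mathrm{div}\,\boldsymbol{\sigma}_h)+(\boldsymbol{f},\boldsymbol{v})=0\quad\forall(\boldsymbol{\tau},\boldsymbol{v})\in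 S_h^0\times V_h.$$ Postprocessing spaces. $P_h:[L^2(\Omega)]^d\to V_h$ is the $L^2$-projection. For an integer $m$, $V^m(K)=[P_m(K)]^d$ and $V_h^m=\{\boldsymbol{v}\in[L^2(\Omega)]^d:\boldsymbol{v}|_K\in V^m(K)\ \forall K\}$. The integer $l$ is $l=k+1$ for ADG, GN, AAW, and $l=2$ for JM. $(I-P_h)V_h^{m}|_K$ and $P_hV_h^m|_K$ denote the spaces of restrictions to $K$ of $(I-P_h)V_h^m$ and $P_hV_h^m$. *)

theory Defs
  imports "HOL-Analysis.Analysis"
begin

section \<open>Lebesgue spaces and polynomials\<close>

text \<open>Fields on a subset of \<open>\<real>\<^sup>d\<close> are total functions on \<open>real^'d\<close>; only their values on the
  set in question matter. On matrices \<open>real^'d^'d\<close> the library inner product is the Frobenius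
  product, so \<open>L2_inner\<close> covers scalar, vector and matrix fields. The measure is \<open>lebesgue_on K\<close>
  for volume integrals and \<open>face_measure E\<close> (below) for face integrals.\<close>

definition L2 :: "'a measure \<Rightarrow> ('a \<Rightarrow> 'b::euclidean_space) set" where
  "L2 M = {u. u \<in> borel_measurable M \<and> integrable M (\<lambda>x. (norm (u x))\<^sup>2)}"

definition L2_inner :: "'a measure \<Rightarrow> ('a \<Rightarrow> 'b::euclidean_space) \<Rightarrow> ('a \<Rightarrow> 'b) \<Rightarrow> real" where
  "L2_inner M u v = (\<integral>x. u x \<bullet> v x \<partial>M)"

definition L2_norm :: "'a measure \<Rightarrow> ('a \<Rightarrow> 'b::euclidean_space) \<Rightarrow> real" where
  "L2_norm M u = sqrt (L2_inner M u u)"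

text \<open>\<open>p\<close> is (a representative of) the \<open>L\<^sup>2\<close>-orthogonal projection of \<open>u\<close> onto \<open>X\<close>.\<close>

definition is_L2_projection ::
    "'a measure \<Rightarrow> ('a \<Rightarrow> 'b::euclidean_space) set \<Rightarrow> ('a \<Rightarrow> 'b) \<Rightarrow> ('a \<Rightarrow> 'b) \<Rightarrow> bool" where
  "is_L2_projection M X u p \<longleftrightarrow> p \<in> X \<and> (\<forall>q\<in>X. L2_inner M (\<lambda>x. u x - p x) q = 0)"

text \<open>Polynomial functions of total degree at most \<open>m\<close>. With coefficients in a vector space
  \<open>'b\<close> these are exactly the fields all of whose components lie in \<open>P\<^sub>m\<close>.\<close>

definition poly_fun :: "nat \<Rightarrow> (real^'d \<Rightarrow> 'b::real_vector) set" where
  "poly_fun m = {p. \<exists>c::('d \<Rightarrow> nat) \<Rightarrow> 'b.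
     \<forall>x. p x = (\<Sum>\<alpha> | (\<Sum>i\<in>UNIV. \<alpha> i) \<le> m. (\<Prod>i\<in>UNIV. (x $ i) ^ \<alpha> i) *\<^sub>R c \<alpha>)}"


section \<open>Domain, mesh and face measure\<close>

definition polyhedral_domain :: "(real^'d) set \<Rightarrow> bool" where
  "polyhedral_domain \<Omega> \<longleftrightarrow> open \<Omega> \<and> connected \<Omega> \<and> interior (closure \<Omega>) = \<Omega> \<and>
     (\<exists>\<P>. finite \<P> \<and> (\<forall>P\<in>\<P>. polytope P) \<and> closure \<Omega> = \<Union>\<P>)"

text \<open>Elements are closed simplices. The library notion \<open>triangulation\<close> supplies finiteness and
  conformity: any two elements meet in a common (possibly empty) face.\<close>

definition simplicial_mesh :: "(real^'d) set \<Rightarrow> (real^'d) set set \<Rightarrow> bool" where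
  "simplicial_mesh \<Omega> \<T> \<longleftrightarrow>
     triangulation \<T> \<and> (\<forall>K\<in>\<T>. int CARD('d) simplex K) \<and> \<Union>\<T> = closure \<Omega>"

definition boundary_faces :: "(real^'d) set \<Rightarrow> (real^'d) set set \<Rightarrow> (real^'d) set set" where
  "boundary_faces \<Omega> \<T> = {E. \<exists>K\<in>\<T>. E facet_of K \<and> E \<subseteq> frontier \<Omega>}"

text \<open>The \<open>(d-1)\<close>-dimensional surface measure on a flat face \<open>E\<close>: project onto the hyperplane of
  \<open>E\<close> the Lebesgue measure on the right prism over \<open>E\<close> of height 1
  (reaching \<open>1/2\<close> to either side of \<open>E\<close>).\<close>

definition face_measure :: "(real^'d) set \<Rightarrow> (real^'d) measure" where
  "face_measure E =
     distr (lebesgue_on {y. closest_point (affine hull E) y \<in> E \<and> infdist y (affine hull E) \<le> 1/2})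
       borel (closest_point (affine hull E))"

definition boundary_measure :: "(real^'d) set \<Rightarrow> (real^'d) set set \<Rightarrow> (real^'d) set \<Rightarrow> ennreal" where
  "boundary_measure \<Omega> \<T> A = (\<Sum>E\<in>boundary_faces \<Omega> \<T>. emeasure (face_measure E) (A \<inter> E))"

text \<open>The last conjunct says that the mesh resolves the splitting of the boundary. Relative
  interiors are used because the two parts are disjoint whereas closed faces share vertices
  and edges.\<close>

definition boundary_splitting ::
    "(real^'d) set \<Rightarrow> (real^'d) set set \<Rightarrow> (real^'d) set \<Rightarrow> (real^'d) set \<Rightarrow> bool" where
  "boundary_splitting \<Omega> \<T> \<Gamma>\<^sub>D \<Gamma>\<^sub>N \<longleftrightarrow>
     \<Gamma>\<^sub>D \<in> sets borel \<and> \<Gamma>\<^sub>N \<in> sets borel \<and>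
     \<Gamma>\<^sub>D \<union> \<Gamma>\<^sub>N = frontier \<Omega> \<and> \<Gamma>\<^sub>D \<inter> \<Gamma>\<^sub>N = {} \<and> boundary_measure \<Omega> \<T> \<Gamma>\<^sub>D > 0 \<and>
     (\<forall>E\<in>boundary_faces \<Omega> \<T>. rel_interior E \<subseteq> \<Gamma>\<^sub>D \<or> rel_interior E \<subseteq> \<Gamma>\<^sub>N)"


section \<open>Differential operators\<close>

text \<open>\<open>grad v x $ i $ j\<close> is the partial derivative of the \<open>i\<close>-th component of \<open>v\<close> in direction \<open>j\<close>.\<close>

definition grad :: "(real^'d \<Rightarrow> real^'d) \<Rightarrow> real^'d \<Rightarrow> real^'d^'d" where
  "grad v x = jacobian v (at x)"

definition eps :: "(real^'d \<Rightarrow> real^'d) \<Rightarrow> real^'d \<Rightarrow> real^'d^'d" where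
  "eps v x = (1/2) *\<^sub>R (grad v x + transpose (grad v x))"

definition compliance :: "real \<Rightarrow> real \<Rightarrow> real^'d^'d \<Rightarrow> real^'d^'d" where
  "compliance \<mu> lam \<tau> =
     (1 / (2 * \<mu>)) *\<^sub>R (\<tau> - (lam / (2 * \<mu> + real CARD('d) * lam) * trace \<tau>) *\<^sub>R mat 1)"

primrec Ck :: "nat \<Rightarrow> (real^'d \<Rightarrow> real^'d) \<Rightarrow> bool" where
  "Ck 0 \<phi> \<longleftrightarrow> continuous_on UNIV \<phi>"
| "Ck (Suc n) \<phi> \<longleftrightarrow> (\<forall>x. \<phi> differentiable (at x)) \<and>
     (\<forall>i. Ck n (\<lambda>x. frechet_derivative \<phi> (at x) (axis i 1)))"

definition support :: "(real^'d \<Rightarrow> real^'d) \<Rightarrow> (real^'d) set" where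
  "support \<phi> = closure {x. \<phi> x \<noteq> 0}"

definition test_fields :: "(real^'d \<Rightarrow> real^'d) set" where
  "test_fields = {\<phi>. (\<forall>n. Ck n \<phi>) \<and> compact (support \<phi>)}"

definition has_weak_div ::
    "(real^'d) set \<Rightarrow> (real^'d \<Rightarrow> real^'d^'d) \<Rightarrow> (real^'d \<Rightarrow> real^'d) \<Rightarrow> bool" where
  "has_weak_div U \<tau> q \<longleftrightarrow> (\<forall>\<phi>\<in>test_fields. support \<phi> \<subseteq> U \<longrightarrow>
     L2_inner (lebesgue_on U) \<tau> (grad \<phi>) = - L2_inner (lebesgue_on U) q \<phi>)"

text \<open>\<open>H(div; U)\<close> with symmetry built in, for open \<open>U\<close>.\<close>

definition Hdiv :: "(real^'d) set \<Rightarrow> (real^'d \<Rightarrow> real^'d^'d) set" where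
  "Hdiv U = {\<tau>\<in>L2 (lebesgue_on U). (AE x in lebesgue_on U. transpose (\<tau> x) = \<tau> x) \<and>
     (\<exists>q\<in>L2 (lebesgue_on U). has_weak_div U \<tau> q)}"

text \<open>The row-wise divergence; the choice is unique almost everywhere in \<open>U\<close>.\<close>

definition divergence ::
    "(real^'d) set \<Rightarrow> (real^'d \<Rightarrow> real^'d^'d) \<Rightarrow> real^'d \<Rightarrow> real^'d" where
  "divergence U \<tau> = (SOME q. q \<in> L2 (lebesgue_on U) \<and> has_weak_div U \<tau> q)"

text \<open>\<open>\<tau> n = q\<close> on the face \<open>E\<close> of \<open>K\<close>, with \<open>n\<close> the outer normal of \<open>K\<close>, in the sense of
  Green's formula: the test fields vanish near the part of the boundary of \<open>K\<close> outside the
  relative interior of \<open>E\<close>.\<close>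

definition normal_trace ::
    "(real^'d) set \<Rightarrow> (real^'d) set \<Rightarrow> (real^'d \<Rightarrow> real^'d^'d) \<Rightarrow> (real^'d \<Rightarrow> real^'d) \<Rightarrow> bool" where
  "normal_trace K E \<tau> q \<longleftrightarrow> q \<in> L2 (face_measure E) \<and>
     (\<forall>\<phi>\<in>test_fields. support \<phi> \<inter> (frontier K - rel_interior E) = {} \<longrightarrow>
        L2_inner (lebesgue_on (interior K)) \<tau> (grad \<phi>)
        + L2_inner (lebesgue_on (interior K)) (divergence (interior K) \<tau>) \<phi>
        = L2_inner (face_measure E) q \<phi>)"


section \<open>Displacement spaces\<close>

text \<open>Elements of the piecewise polynomial displacement spaces are represented by functions that
  are polynomial pointwise on the interior of every element, so that classical derivatives give
  the elementwise strain. Interiors are needed since the fields jump across faces.\<close>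

definition V_loc :: "nat \<Rightarrow> (real^'d) set \<Rightarrow> (real^'d \<Rightarrow> real^'d) set" where
  "V_loc m K = {v. \<exists>p\<in>poly_fun m. \<forall>x\<in>interior K. v x = p x}"

definition V_pw :: "(real^'d) set \<Rightarrow> (real^'d) set set \<Rightarrow> nat \<Rightarrow> (real^'d \<Rightarrow> real^'d) set" where
  "V_pw \<Omega> \<T> m = {v\<in>L2 (lebesgue_on \<Omega>). \<forall>K\<in>\<T>. v \<in> V_loc m K}"

datatype element_family = ADG | GN | AAW | JM

fun family_dim :: "element_family \<Rightarrow> nat" where
  "family_dim AAW = 3" | "family_dim _ = 2"

text \<open>The parameter \<open>k\<close> is not used for the family JM.\<close>

definition disp_degree :: "element_family \<Rightarrow> nat \<Rightarrow> nat" where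
  "disp_degree fam k = (if fam = JM then 1 else k - 1)"

definition trace_degree :: "element_family \<Rightarrow> nat \<Rightarrow> nat" where
  "trace_degree fam k = (if fam = JM then 1 else k)"

definition post_degree :: "element_family \<Rightarrow> nat \<Rightarrow> nat" where
  "post_degree fam k = (if fam = JM then 2 else k + 1)"

definition V_h ::
    "element_family \<Rightarrow> nat \<Rightarrow> (real^'d) set \<Rightarrow> (real^'d) set set \<Rightarrow> (real^'d \<Rightarrow> real^'d) set" where
  "V_h fam k \<Omega> \<T> = V_pw \<Omega> \<T> (disp_degree fam k)"

text \<open>\<open>P\<^sub>h V\<^sub>h\<^sup>m\<close> and \<open>(I - P\<^sub>h) V\<^sub>h\<^sup>m\<close>, with all representatives of the projections.\<close>

definition Ph_V ::
    "element_family \<Rightarrow> nat \<Rightarrow> (real^'d) set \<Rightarrow> (real^'d) set set \<Rightarrow> nat \<Rightarrow> (real^'d \<Rightarrow> real^'d) set" where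
  "Ph_V fam k \<Omega> \<T> m =
     {p |v p. v \<in> V_pw \<Omega> \<T> m \<and> is_L2_projection (lebesgue_on \<Omega>) (V_h fam k \<Omega> \<T>) v p}"

definition I_minus_Ph_V ::
    "element_family \<Rightarrow> nat \<Rightarrow> (real^'d) set \<Rightarrow> (real^'d) set set \<Rightarrow> nat \<Rightarrow> (real^'d \<Rightarrow> real^'d) set" where
  "I_minus_Ph_V fam k \<Omega> \<T> m =
     {(\<lambda>x. v x - p x) |v p. v \<in> V_pw \<Omega> \<T> m \<and> is_L2_projection (lebesgue_on \<Omega>) (V_h fam k \<Omega> \<T>) v p}"

text \<open>Restrictions to \<open>K\<close> of the members of \<open>X\<close>; values outside the interior of \<open>K\<close> are
  irrelevant.\<close>

definition restrictions :: "(real^'d) set \<Rightarrow> (real^'d \<Rightarrow> real^'d) set \<Rightarrow> (real^'d \<Rightarrow> real^'d) set" where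
  "restrictions K X = {w. \<exists>v\<in>X. \<forall>x\<in>interior K. w x = v x}"


section \<open>Stress spaces\<close>

definition restricts_into ::
    "(real^'d) set \<Rightarrow> (real^'d \<Rightarrow> real^'d^'d) set \<Rightarrow> (real^'d \<Rightarrow> real^'d^'d) \<Rightarrow> bool" where
  "restricts_into K S \<tau> \<longleftrightarrow> (\<exists>s\<in>S. AE x in lebesgue_on K. \<tau> x = s x)"

definition S_h ::
    "(real^'d) set \<Rightarrow> (real^'d) set set \<Rightarrow> ((real^'d) set \<Rightarrow> (real^'d \<Rightarrow> real^'d^'d) set)
      \<Rightarrow> (real^'d \<Rightarrow> real^'d^'d) set" where
  "S_h \<Omega> \<T> S = {\<tau>\<in>Hdiv \<Omega>. \<forall>K\<in>\<T>. restricts_into K (S K) \<tau>}"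

text \<open>Johnson--Mercier: the cells of the barycentric split of \<open>K\<close> are the convex hulls of the
  barycenter and one face of \<open>K\<close>.\<close>

definition barycenter :: "(real^'d) set \<Rightarrow> real^'d" where
  "barycenter K = (1 / real (card {a. a extreme_point_of K})) *\<^sub>R \<Sum>{a. a extreme_point_of K}"

definition JM_space :: "(real^'d) set \<Rightarrow> (real^'d \<Rightarrow> real^'d^'d) set" where
  "JM_space K = {\<tau>\<in>Hdiv (interior K). \<forall>E. E facet_of K \<longrightarrow>
     (\<exists>p\<in>poly_fun 1. AE x in lebesgue_on (convex hull (insert (barycenter K) E)). \<tau> x = p x)}"

text \<open>The properties that ADG, GN and AAW elements have in common. That the moments against
  \<open>\<epsilon>(v)\<close> and the face moments are degrees of freedom means that they can be prescribed
  independently. They need not determine a field: for larger \<open>k\<close> (already because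
  all symmetric \<open>P\<^sub>k\<close> fields belong to the space) the full set of degrees of freedom contains
  moments against fields with zero divergence and zero normal trace as well. Prescribed
  values are given through Riesz representers \<open>v0\<close> and \<open>r E\<close>.\<close>

definition moment_stress_element ::
    "nat \<Rightarrow> (real^'d) set \<Rightarrow> (real^'d \<Rightarrow> real^'d^'d) set \<Rightarrow> bool" where
  "moment_stress_element k K S \<longleftrightarrow>
     S \<subseteq> Hdiv (interior K) \<and> (\<lambda>x. 0) \<in> S \<and>
     (\<forall>s\<in>S. \<forall>t\<in>S. (\<lambda>x. s x + t x) \<in> S) \<and> (\<forall>c. \<forall>s\<in>S. (\<lambda>x. c *\<^sub>R s x) \<in> S) \<and>
     (\<forall>p\<in>poly_fun k. (\<forall>x. transpose (p x) = p x) \<longrightarrow> restricts_into K S p) \<and>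
     (\<forall>s\<in>S. \<forall>E. E facet_of K \<longrightarrow> (\<exists>q. normal_trace K E s q)) \<and>
     (\<forall>v0\<in>poly_fun (k - 1). \<forall>r. (\<forall>E. E facet_of K \<longrightarrow> r E \<in> poly_fun k) \<longrightarrow>
       (\<exists>s\<in>S.
         (\<forall>v\<in>poly_fun (k - 1).
            L2_inner (lebesgue_on K) s (eps v) = L2_inner (lebesgue_on K) (eps v0) (eps v)) \<and>
         (\<forall>E. E facet_of K \<longrightarrow> (\<exists>q. normal_trace K E s q \<and>
            (\<forall>v\<in>poly_fun k. L2_inner (face_measure E) q v = L2_inner (face_measure E) (r E) v)))))"

text \<open>The local stress spaces \<open>S K\<close> are those of the family \<open>fam\<close> (of degree \<open>k\<close>).\<close>

definition stress_family ::
    "element_family \<Rightarrow> nat \<Rightarrow> (real^'d) set \<Rightarrow> (real^'d) set set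
      \<Rightarrow> ((real^'d) set \<Rightarrow> (real^'d \<Rightarrow> real^'d^'d) set) \<Rightarrow> bool" where
  "stress_family fam k \<Omega> \<T> S \<longleftrightarrow> CARD('d) = family_dim fam \<and>
     (if fam = JM then \<forall>K\<in>\<T>. S K = JM_space K
      else k \<ge> 2 \<and> (\<forall>K\<in>\<T>. moment_stress_element k K (S K)) \<and>
        (\<forall>\<tau>\<in>S_h \<Omega> \<T> S. \<exists>v\<in>V_h fam k \<Omega> \<T>. has_weak_div \<Omega> \<tau> v))"

definition S_h_g ::
    "element_family \<Rightarrow> nat \<Rightarrow> (real^'d) set \<Rightarrow> (real^'d) set \<Rightarrow> (real^'d) set set
      \<Rightarrow> ((real^'d) set \<Rightarrow> (real^'d \<Rightarrow> real^'d^'d) set) \<Rightarrow> (real^'d \<Rightarrow> real^'d)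
      \<Rightarrow> (real^'d \<Rightarrow> real^'d^'d) set" where
  "S_h_g fam k \<Omega> \<Gamma>\<^sub>N \<T> S g = {\<tau>\<in>S_h \<Omega> \<T> S.
     \<forall>K\<in>\<T>. \<forall>E. E facet_of K \<and> rel_interior E \<subseteq> \<Gamma>\<^sub>N \<longrightarrow>
       (\<exists>q. is_L2_projection (face_measure E) (poly_fun (trace_degree fam k)) g q \<and>
            normal_trace K E \<tau> q)}"

definition S_h_0 ::
    "(real^'d) set \<Rightarrow> (real^'d) set \<Rightarrow> (real^'d) set set
      \<Rightarrow> ((real^'d) set \<Rightarrow> (real^'d \<Rightarrow> real^'d^'d) set) \<Rightarrow> (real^'d \<Rightarrow> real^'d^'d) set" where
  "S_h_0 \<Omega> \<Gamma>\<^sub>N \<T> S = {\<tau>\<in>S_h \<Omega> \<T> S.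
     \<forall>K\<in>\<T>. \<forall>E. E facet_of K \<and> rel_interior E \<subseteq> \<Gamma>\<^sub>N \<longrightarrow> normal_trace K E \<tau> (\<lambda>x. 0)}"

definition discrete_solution ::
    "real \<Rightarrow> real \<Rightarrow> element_family \<Rightarrow> nat \<Rightarrow> (real^'d) set \<Rightarrow> (real^'d) set \<Rightarrow> (real^'d) set set
      \<Rightarrow> ((real^'d) set \<Rightarrow> (real^'d \<Rightarrow> real^'d^'d) set)
      \<Rightarrow> (real^'d \<Rightarrow> real^'d) \<Rightarrow> (real^'d \<Rightarrow> real^'d)
      \<Rightarrow> (real^'d \<Rightarrow> real^'d^'d) \<Rightarrow> (real^'d \<Rightarrow> real^'d) \<Rightarrow> bool" where
  "discrete_solution \<mu> lam fam k \<Omega> \<Gamma>\<^sub>N \<T> S f g \<sigma> u \<longleftrightarrow>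
     \<sigma> \<in> S_h_g fam k \<Omega> \<Gamma>\<^sub>N \<T> S g \<and> u \<in> V_h fam k \<Omega> \<T> \<and>
     (\<forall>\<tau>\<in>S_h_0 \<Omega> \<Gamma>\<^sub>N \<T> S. \<forall>v\<in>V_h fam k \<Omega> \<T>.
        L2_inner (lebesgue_on \<Omega>) (\<lambda>x. compliance \<mu> lam (\<sigma> x)) \<tau>
        + L2_inner (lebesgue_on \<Omega>) u (divergence \<Omega> \<tau>)
        + L2_inner (lebesgue_on \<Omega>) v (divergence \<Omega> \<sigma>)
        + L2_inner (lebesgue_on \<Omega>) f v = 0)"


section \<open>The dual norm of the residual\<close>

definition star_norm ::
    "element_family \<Rightarrow> nat \<Rightarrow> (real^'d) set \<Rightarrow> (real^'d) set set \<Rightarrow> (real^'d) set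
      \<Rightarrow> (real^'d \<Rightarrow> real^'d^'d) \<Rightarrow> real" where
  "star_norm fam k \<Omega> \<T> K \<tau> =
     (SUP v\<in>{v\<in>restrictions K (I_minus_Ph_V fam k \<Omega> \<T> (post_degree fam k + 1)).
              \<exists>x\<in>interior K. v x \<noteq> 0}.
        L2_inner (lebesgue_on K) \<tau> (eps v) / L2_norm (lebesgue_on K) (eps v))"

end

theory Submission
  imports Defs
begin

text \<open>Everything happens on one element \<open>K\<close> with interior \<open>U\<close>. Write \<open>n\<close> for the degree of the
  displacement space, \<open>l\<close> for that of the postprocessing space, and \<open>W\<^sub>m\<close> for the polynomial fields
  of degree at most \<open>m\<close> that are \<open>L\<^sup>2(U)\<close>-orthogonal to all fields of degree at most \<open>n\<close>
  (\<open>orth_poly n m U\<close>). Cutting a polynomial off outside \<open>U\<close> gives a member of the global piecewise space, hence the restrictions of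
  \<open>(I - P\<^sub>h) V\<^sub>h\<^sup>m\<close> to \<open>K\<close> are exactly \<open>W\<^sub>m\<close> (\<open>restrictions_I_minus_Ph_V\<close>), and testing with
  \<open>P\<^sub>h V\<^sub>h\<^sup>l\<close> means testing with all fields of degree at most \<open>n\<close>. Both the postprocessed field
  \<open>u\<close> and the minimizer \<open>w\<close> satisfy these constraints, so \<open>e = u - w\<close> lies in \<open>W\<^sub>l\<close>, and \<open>u\<close> is
  a competitor in the minimization.

  Let \<open>r = C\<sigma> - \<epsilon>(u)\<close>. The defining equations of \<open>u\<close> say that \<open>r\<close> is orthogonal to
  \<open>\<epsilon>(W\<^sub>l)\<close>, and the residual of \<open>w\<close> is \<open>r + \<epsilon>(e)\<close>. The dual norm of a field is the \<open>L\<^sup>2\<close> norm of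
  its projection onto \<open>\<epsilon>(W\<^bsub>l+1\<^esub>)\<close>, a space that contains \<open>\<epsilon>(e)\<close> because \<open>W\<^sub>l \<subseteq> W\<^bsub>l+1\<^esub>\<close>. Hence
  Pythagoras holds for it: passing from \<open>u\<close> to \<open>w\<close> raises the square of the dual norm by
  \<open>\<parallel>\<epsilon>(e)\<parallel>\<^sup>2\<close> (\<open>dual_norm_pythagoras\<close>, which gives the inequality \<open>\<ge>\<close> by comparing suprema in
  the planes spanned by \<open>e\<close> and one test field). As \<open>w\<close> is a minimizer, \<open>\<epsilon>(e) = 0\<close>. Then \<open>e\<close> is an infinitesimal rigid
  motion, in particular affine (\<open>affine_if_eps_zero\<close>). Since \<open>n \<ge> 1\<close>, affine fields are among those
  that \<open>e\<close> is orthogonal to, so \<open>e = 0\<close> on \<open>U\<close>. The interiors of the elements cover \<open>\<Omega>\<close> up to a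
  null set.\<close>

section \<open>The L2 inner product\<close>

lemma L2_inner_commute: "L2_inner M u v = L2_inner M v u"
  by (simp add: L2_inner_def inner_commute)

lemma L2_inner_cong:
  assumes "\<And>x. x \<in> space M \<Longrightarrow> u x = u' x" "\<And>x. x \<in> space M \<Longrightarrow> v x = v' x"
  shows "L2_inner M u v = L2_inner M u' v'"
  unfolding L2_inner_def by (rule Bochner_Integration.integral_cong) (simp_all add: assms)

lemma L2_inner_self_nonneg: "0 \<le> L2_inner M u u"
  unfolding L2_inner_def by (rule Bochner_Integration.integral_nonneg) simp

lemma L2_integrable_inner:
  assumes "u \<in> L2 M" "v \<in> L2 M"
  shows "integrable M (\<lambda>x. u x \<bullet> v x)"
proof (rule Bochner_Integration.integrable_bound)
  show "integrable M (\<lambda>x. (norm (u x))\<^sup>2 + (norm (v x))\<^sup>2)"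
    using assms by (simp add: L2_def)
  show "(\<lambda>x. u x \<bullet> v x) \<in> borel_measurable M"
    using assms by (auto simp: L2_def intro: borel_measurable_inner)
  have "\<bar>a \<bullet> b\<bar> \<le> (norm a)\<^sup>2 + (norm b)\<^sup>2" for a b :: 'b
  proof -
    have "\<bar>a \<bullet> b\<bar> \<le> norm a * norm b" by (rule Cauchy_Schwarz_ineq2)
    also have "norm a * norm b \<le> (norm a)\<^sup>2 + (norm b)\<^sup>2"
      using sum_squares_bound[of "norm a" "norm b"] mult_nonneg_nonneg[OF norm_ge_zero norm_ge_zero, of a b]
      by linarith
    finally show ?thesis .
  qed
  then show "AE x in M. norm (u x \<bullet> v x) \<le> norm ((norm (u x))\<^sup>2 + (norm (v x))\<^sup>2)"
    by simp
qed

lemma L2_combine: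
  assumes "u \<in> L2 M" "v \<in> L2 M"
  shows "(\<lambda>x. a *\<^sub>R u x + b *\<^sub>R v x) \<in> L2 M"
proof -
  have "integrable M (\<lambda>x. a\<^sup>2 * (u x \<bullet> u x) + 2 * a * b * (u x \<bullet> v x) + b\<^sup>2 * (v x \<bullet> v x))"
    using L2_integrable_inner[OF assms(1,1)] L2_integrable_inner[OF assms(1,2)]
      L2_integrable_inner[OF assms(2,2)] by (intro Bochner_Integration.integrable_add) auto
  moreover have "(norm (a *\<^sub>R u x + b *\<^sub>R v x))\<^sup>2
      = a\<^sup>2 * (u x \<bullet> u x) + 2 * a * b * (u x \<bullet> v x) + b\<^sup>2 * (v x \<bullet> v x)" for x
    unfolding power2_norm_eq_inner
    by (simp add: inner_simps inner_commute power2_eq_square algebra_simps)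
  ultimately show ?thesis
    using assms by (auto simp: L2_def)
qed

lemma L2_inner_combine_right:
  assumes "w \<in> L2 M" "u \<in> L2 M" "v \<in> L2 M"
  shows "L2_inner M w (\<lambda>x. a *\<^sub>R u x + b *\<^sub>R v x) = a * L2_inner M w u + b * L2_inner M w v"
  using L2_integrable_inner[OF assms(1,2)] L2_integrable_inner[OF assms(1,3)]
  by (simp add: L2_inner_def inner_add_right)

lemma L2_inner_combine_left:
  assumes "w \<in> L2 M" "u \<in> L2 M" "v \<in> L2 M"
  shows "L2_inner M (\<lambda>x. a *\<^sub>R u x + b *\<^sub>R v x) w = a * L2_inner M u w + b * L2_inner M v w"
  using L2_inner_combine_right[OF assms] by (simp add: L2_inner_commute)

lemma L2_inner_combine_self:
  assumes "u \<in> L2 M" "v \<in> L2 M"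
  shows "L2_inner M (\<lambda>x. a *\<^sub>R u x + b *\<^sub>R v x) (\<lambda>x. a *\<^sub>R u x + b *\<^sub>R v x)
    = a\<^sup>2 * L2_inner M u u + 2 * a * b * L2_inner M u v + b\<^sup>2 * L2_inner M v v"
  using assms L2_combine[OF assms]
  by (simp add: L2_inner_combine_right L2_inner_combine_left L2_inner_commute[of M v u]
      power2_eq_square algebra_simps)

lemma L2_Cauchy_Schwarz:
  assumes "u \<in> L2 M" "v \<in> L2 M"
  shows "(L2_inner M u v)\<^sup>2 \<le> L2_inner M u u * L2_inner M v v"
proof -
  have quad: "0 \<le> a\<^sup>2 * L2_inner M u u + 2 * a * b * L2_inner M u v + b\<^sup>2 * L2_inner M v v" for a b
    using L2_inner_self_nonneg[of M "\<lambda>x. a *\<^sub>R u x + b *\<^sub>R v x"] L2_inner_combine_self[OF assms]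
    by simp
  define A B C where "A = L2_inner M u u" "B = L2_inner M u v" "C = L2_inner M v v"
  have AC: "A \<ge> 0" "C \<ge> 0" by (auto simp: A_B_C_def L2_inner_self_nonneg)
  have q: "0 \<le> a\<^sup>2 * A + 2 * a * b * B + b\<^sup>2 * C" for a b
    using quad[of a b] by (simp add: A_B_C_def)
  have "B\<^sup>2 \<le> A * C"
  proof (cases "A + C = 0")
    case True
    then have "A = 0" "C = 0" using AC by auto
    then show ?thesis using q[of 1 1] q[of 1 "-1"] by simp
  next
    case False
    have "0 \<le> C * (A * C - B\<^sup>2)" "0 \<le> A * (A * C - B\<^sup>2)"
      using q[of C "-B"] q[of B "-A"] by (simp_all add: power2_eq_square algebra_simps)
    then have "0 \<le> (A + C) * (A * C - B\<^sup>2)" by (simp add: algebra_simps)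
    then show ?thesis using False AC by (simp add: zero_le_mult_iff)
  qed
  then show ?thesis by (simp add: A_B_C_def)
qed

text \<open>Strains of elementwise polynomial fields are controlled only in the interior of an element.
  As the boundary of a convex set is a null set, integrals over the element do not see it. The
  integrand may be any function, measurable or not: by completeness of the Lebesgue measure both
  integrands are then measurable or neither is, and in the second case both integrals are \<open>0\<close>.\<close>

lemma L2_inner_interior:
  fixes K :: "'a::euclidean_space set" and u v :: "'a \<Rightarrow> 'b::euclidean_space"
  assumes "convex K" "closed K"
  shows "L2_inner (lebesgue_on K) u v = L2_inner (lebesgue_on (interior K)) u v"
proof -
  let ?g = "\<lambda>S x. if x \<in> S then u x \<bullet> v x else 0"
  have meas: "K \<in> sets lebesgue" "interior K \<in> sets lebesgue"
    using assms by auto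
  have "AE x in lebesgue. x \<notin> frontier K"
    using negligible_convex_frontier[OF \<open>convex K\<close>] by (simp add: AE_not_in negligible_iff_null_sets)
  then have ae: "AE x in lebesgue. ?g K x = ?g (interior K) x"
  proof (rule eventually_mono)
    fix x assume "x \<notin> frontier K"
    then have "x \<in> K \<longleftrightarrow> x \<in> interior K"
      using assms(2) interior_subset by (auto simp: frontier_def)
    then show "?g K x = ?g (interior K) x" by simp
  qed
  have "integral\<^sup>L lebesgue (?g K) = integral\<^sup>L lebesgue (?g (interior K))"
  proof (cases "?g K \<in> borel_measurable lebesgue")
    case True
    then have "?g (interior K) \<in> borel_measurable lebesgue"
      using ae by (rule borel_measurable_AE)
    with True show ?thesis using ae by (rule integral_cong_AE)
  next
    case False
    have "?g (interior K) \<notin> borel_measurable lebesgue"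
    proof
      assume "?g (interior K) \<in> borel_measurable lebesgue"
      moreover have "AE x in lebesgue. ?g (interior K) x = ?g K x"
        using ae by (rule eventually_mono) (rule sym)
      ultimately have "?g K \<in> borel_measurable lebesgue"
        by (rule borel_measurable_AE)
      then show False using False by simp
    qed
    then have "\<not> integrable lebesgue (?g K)" "\<not> integrable lebesgue (?g (interior K))"
      using False by (meson borel_measurable_integrable)+
    then show ?thesis
      using not_integrable_integral_eq[of lebesgue "?g K"]
        not_integrable_integral_eq[of lebesgue "?g (interior K)"] by argo
  qed
  then show ?thesis
    unfolding L2_inner_def by (simp add: Lebesgue_Measure.integral_restrict_UNIV meas)
qed

lemma continuous_in_L2:
  fixes u :: "'a::euclidean_space \<Rightarrow> 'b::euclidean_space"
  assumes "continuous_on UNIV u" "U \<in> sets lebesgue" "bounded U"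
  shows "u \<in> L2 (lebesgue_on U)"
proof -
  have "compact (u ` closure U)"
    using assms by (meson compact_closure compact_continuous_image continuous_on_subset subset_UNIV)
  then have "bounded (u ` U)"
    using closure_subset[of U] by (meson bounded_subset compact_imp_bounded image_mono)
  then obtain B where B: "\<And>x. x \<in> U \<Longrightarrow> norm (u x) \<le> B"
    by (auto simp: bounded_iff)
  have [measurable]: "u \<in> borel_measurable (lebesgue_on U)"
    using continuous_imp_measurable_on_sets_lebesgue[OF continuous_on_subset[OF assms(1) subset_UNIV] assms(2)] .
  interpret finite_measure "lebesgue_on U"
    using assms bounded_set_imp_lmeasurable finite_measure_lebesgue_on by blast
  have "integrable (lebesgue_on U) (\<lambda>x. (norm (u x))\<^sup>2)"
  proof (rule integrable_const_bound[where B = "B\<^sup>2"])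
    show "AE x in lebesgue_on U. norm ((norm (u x))\<^sup>2) \<le> B\<^sup>2"
      using B by (intro AE_I2) (auto intro!: power_mono)
  qed measurable
  then show ?thesis by (simp add: L2_def)
qed

text \<open>Passes from almost everywhere to everywhere: the set where a continuous field differs from
  \<open>0\<close> is open, and a nonempty open set is not null.\<close>

lemma continuous_L2_definite:
  fixes u :: "'a::euclidean_space \<Rightarrow> 'b::euclidean_space"
  assumes cont: "continuous_on UNIV u" and U: "open U" "bounded U"
    and zero: "L2_inner (lebesgue_on U) u u = 0"
    and x: "x \<in> U"
  shows "u x = 0"
proof (rule ccontr)
  assume nz: "u x \<noteq> 0"
  have meas: "U \<in> sets lebesgue" using U by simp
  have "u \<in> L2 (lebesgue_on U)" by (rule continuous_in_L2[OF cont meas U(2)])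
  then have "AE y in lebesgue_on U. u y \<bullet> u y = 0"
    using zero integral_nonneg_eq_0_iff_AE[OF L2_integrable_inner[of u _ u]] by (simp add: L2_inner_def)
  then have "AE y in lebesgue. y \<in> U \<longrightarrow> u y = 0"
    using meas by (simp add: AE_restrict_space_iff)
  then have "negligible {y. \<not> (y \<in> U \<longrightarrow> u y = 0)}"
    by (simp add: negligible_iff_null_sets completion.AE_iff_null_sets)
  moreover have "{y. \<not> (y \<in> U \<longrightarrow> u y = 0)} = U \<inter> u -` (- {0})" by auto
  moreover have "open (U \<inter> u -` (- {0}))"
    using U continuous_on_subset[OF cont subset_UNIV] by (intro continuous_open_preimage) auto
  ultimately show False
    using open_not_negligible[of "U \<inter> u -` (- {0})"] x nz by auto
qed

lemma L2_linear_image: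
  fixes T :: "'b::euclidean_space \<Rightarrow> 'c::euclidean_space"
  assumes T: "linear T" and u: "u \<in> L2 M"
  shows "(\<lambda>x. T (u x)) \<in> L2 M"
proof -
  obtain B where B: "\<And>y. norm (T y) \<le> B * norm y"
    using linear_bounded[OF T] by blast
  have [measurable]: "u \<in> borel_measurable M" using u by (simp add: L2_def)
  have [measurable]: "T \<in> borel_measurable borel"
    using T by (intro borel_measurable_continuous_onI linear_continuous_on) (simp add: linear_conv_bounded_linear)
  have "integrable M (\<lambda>x. (norm (T (u x)))\<^sup>2)"
  proof (rule Bochner_Integration.integrable_bound)
    show "integrable M (\<lambda>x. B\<^sup>2 * (norm (u x))\<^sup>2)" using u by (simp add: L2_def)
    have "(norm (T (u x)))\<^sup>2 \<le> (B * norm (u x))\<^sup>2" for x using B by (intro power_mono) auto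
    then show "AE x in M. norm ((norm (T (u x)))\<^sup>2) \<le> norm (B\<^sup>2 * (norm (u x))\<^sup>2)"
      by (simp add: power_mult_distrib)
  qed measurable
  then show ?thesis by (simp add: L2_def)
qed

lemma L2_lebesgue_on_subset:
  fixes u :: "'a::euclidean_space \<Rightarrow> 'b::euclidean_space"
  assumes u: "u \<in> L2 (lebesgue_on \<Omega>)" and "U \<subseteq> \<Omega>" "U \<in> sets lebesgue" "\<Omega> \<in> sets lebesgue"
  shows "u \<in> L2 (lebesgue_on U)"
proof -
  have "u \<in> borel_measurable (lebesgue_on U)"
    using u \<open>U \<subseteq> \<Omega>\<close> measurable_restrict_mono unfolding L2_def by blast
  moreover have "set_integrable lebesgue U (\<lambda>x. (norm (u x))\<^sup>2)"
    by (rule set_integrable_subset[of _ \<Omega>])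
      (use assms in \<open>simp_all add: L2_def integrable_restrict_space set_integrable_def\<close>)
  ultimately show ?thesis
    using \<open>U \<in> sets lebesgue\<close> by (simp add: L2_def integrable_restrict_space set_integrable_def)
qed

lemma linear_compliance: "linear (compliance \<mu> lam)"
  by (rule linearI) (simp_all add: compliance_def trace_def vec_eq_iff sum.distrib
      sum_distrib_left[symmetric] algebra_simps)

section \<open>Polynomial fields\<close>

lemma finite_multi_indices: "finite {\<alpha> :: 'd::finite \<Rightarrow> nat. (\<Sum>i\<in>UNIV. \<alpha> i) \<le> m}"
proof (rule finite_subset)
  show "{\<alpha> :: 'd \<Rightarrow> nat. (\<Sum>i\<in>UNIV. \<alpha> i) \<le> m} \<subseteq> PiE UNIV (\<lambda>_. {..m})"
  proof
    fix \<alpha> :: "'d \<Rightarrow> nat" assume "\<alpha> \<in> {\<alpha>. (\<Sum>i\<in>UNIV. \<alpha> i) \<le> m}"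
    moreover have "\<alpha> i \<le> (\<Sum>i\<in>UNIV. \<alpha> i)" for i
      by (rule member_le_sum) simp_all
    ultimately show "\<alpha> \<in> PiE UNIV (\<lambda>_. {..m})"
      by (simp add: PiE_def Pi_def) (meson order_trans)
  qed
  show "finite (PiE (UNIV :: 'd set) (\<lambda>_. {..m}))"
    by (intro finite_PiE) auto
qed

lemma poly_fun_combine:
  assumes "p \<in> poly_fun m" "q \<in> poly_fun m"
  shows "(\<lambda>x. a *\<^sub>R p x + b *\<^sub>R q x) \<in> poly_fun m"
proof -
  obtain c where c: "\<And>x. p x = (\<Sum>\<alpha> | (\<Sum>i\<in>UNIV. \<alpha> i) \<le> m. (\<Prod>i\<in>UNIV. (x $ i) ^ \<alpha> i) *\<^sub>R c \<alpha>)"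
    using assms(1) by (auto simp: poly_fun_def)
  obtain d where d: "\<And>x. q x = (\<Sum>\<alpha> | (\<Sum>i\<in>UNIV. \<alpha> i) \<le> m. (\<Prod>i\<in>UNIV. (x $ i) ^ \<alpha> i) *\<^sub>R d \<alpha>)"
    using assms(2) by (auto simp: poly_fun_def)
  have "a *\<^sub>R p x + b *\<^sub>R q x = (\<Sum>\<alpha> | (\<Sum>i\<in>UNIV. \<alpha> i) \<le> m.
      (\<Prod>i\<in>UNIV. (x $ i) ^ \<alpha> i) *\<^sub>R (a *\<^sub>R c \<alpha> + b *\<^sub>R d \<alpha>))" for x
    unfolding c d by (simp add: scaleR_add_right sum.distrib scaleR_sum_right mult.commute)
  then show ?thesis
    unfolding poly_fun_def by (intro CollectI exI[of _ "\<lambda>\<alpha>. a *\<^sub>R c \<alpha> + b *\<^sub>R d \<alpha>"] allI)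
qed

lemma poly_fun_add: "p \<in> poly_fun m \<Longrightarrow> q \<in> poly_fun m \<Longrightarrow> (\<lambda>x. p x + q x) \<in> poly_fun m"
  using poly_fun_combine[of p m q 1 1] by simp

lemma poly_fun_zero: "(\<lambda>x. 0) \<in> poly_fun m"
  unfolding poly_fun_def by (rule CollectI, rule exI[of _ "\<lambda>_. 0"]) simp

lemma poly_fun_sum:
  "finite I \<Longrightarrow> (\<And>i. i \<in> I \<Longrightarrow> p i \<in> poly_fun m) \<Longrightarrow> (\<lambda>x. \<Sum>i\<in>I. p i x) \<in> poly_fun m"
  by (induction I rule: finite_induct) (auto intro: poly_fun_zero poly_fun_add)

lemma poly_fun_monomial:
  assumes "(\<Sum>i\<in>UNIV. \<beta> i) \<le> m"
  shows "(\<lambda>x. (\<Prod>i\<in>UNIV. (x $ i) ^ \<beta> i) *\<^sub>R b) \<in> poly_fun m"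
proof -
  have "(\<Prod>i\<in>UNIV. (x $ i) ^ \<beta> i) *\<^sub>R b = (\<Sum>\<alpha> | (\<Sum>i\<in>UNIV. \<alpha> i) \<le> m.
      (\<Prod>i\<in>UNIV. (x $ i) ^ \<alpha> i) *\<^sub>R (if \<alpha> = \<beta> then b else 0))" for x :: "real^'a"
    using assms
    by (simp add: finite_multi_indices if_distrib[of "\<lambda>t. _ *\<^sub>R t"] sum.delta cong: if_cong)
  then show ?thesis
    unfolding poly_fun_def by (intro CollectI exI[of _ "\<lambda>\<alpha>. if \<alpha> = \<beta> then b else 0"] allI)
qed

lemma poly_fun_mono:
  fixes p :: "real^'d \<Rightarrow> 'b::real_vector"
  assumes p: "p \<in> poly_fun m" and "m \<le> n"
  shows "p \<in> poly_fun n"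
proof -
  obtain c where c: "\<And>x. p x = (\<Sum>\<alpha> | (\<Sum>i\<in>UNIV. \<alpha> i) \<le> m. (\<Prod>i\<in>UNIV. (x $ i) ^ \<alpha> i) *\<^sub>R c \<alpha>)"
    using p by (auto simp: poly_fun_def)
  have "(\<lambda>x. \<Sum>\<alpha> | (\<Sum>i\<in>UNIV. \<alpha> i) \<le> m. (\<Prod>i\<in>UNIV. (x $ i) ^ \<alpha> i) *\<^sub>R c \<alpha>) \<in> poly_fun n"
    using \<open>m \<le> n\<close> by (intro poly_fun_sum finite_multi_indices poly_fun_monomial) auto
  then show ?thesis using c by presburger
qed

lemma poly_fun_affine:
  fixes w :: "'d::finite \<Rightarrow> 'b::real_vector"
  shows "(\<lambda>x::real^'d. b + (\<Sum>i\<in>UNIV. x $ i *\<^sub>R w i)) \<in> poly_fun 1"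
proof -
  have "(\<lambda>x::real^'d. (\<Prod>i\<in>UNIV. (x $ i) ^ 0) *\<^sub>R b) \<in> poly_fun 1"
    by (rule poly_fun_monomial) simp
  then have const: "(\<lambda>x::real^'d. b) \<in> poly_fun 1" by simp
  have "(\<lambda>x::real^'d. x $ j *\<^sub>R w j) \<in> poly_fun 1" for j
  proof -
    have "(x $ i) ^ (if i = j then 1 else 0) = (if i = j then x $ i else 1)" for i and x :: "real^'d"
      by simp
    then have "(\<Prod>i\<in>UNIV. (x $ i) ^ (if i = j then 1 else 0)) = x $ j" for x :: "real^'d"
      by (simp add: prod.delta)
    then show ?thesis
      using poly_fun_monomial[of "\<lambda>i. if i = j then 1 else 0" 1 "w j"] by simp
  qed
  then show ?thesis by (intro poly_fun_add const poly_fun_sum) auto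
qed

text \<open>The form in which smoothness enters: it makes the strain a continuous field, hence a square
  integrable one on bounded sets.\<close>

lemma poly_fun_C1:
  fixes p :: "real^'d \<Rightarrow> 'b::real_normed_vector"
  assumes "p \<in> poly_fun m"
  obtains p' where "\<And>x. (p has_derivative p' x) (at x)" "\<And>h. continuous_on UNIV (\<lambda>x. p' x h)"
proof -
  obtain c where "\<And>x. p x = (\<Sum>\<alpha> | (\<Sum>i\<in>UNIV. \<alpha> i) \<le> m. (\<Prod>i\<in>UNIV. (x $ i) ^ \<alpha> i) *\<^sub>R c \<alpha>)"
    using assms by (auto simp: poly_fun_def)
  then have c: "p = (\<lambda>x. \<Sum>\<alpha> | (\<Sum>i\<in>UNIV. \<alpha> i) \<le> m. (\<Prod>i\<in>UNIV. (x $ i) ^ \<alpha> i) *\<^sub>R c \<alpha>)"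
    by blast
  define p' where "p' x h = (\<Sum>\<alpha> | (\<Sum>i\<in>UNIV. \<alpha> i) \<le> m.
      (\<Sum>i\<in>UNIV. (of_nat (\<alpha> i) * h $ i * (x $ i) ^ (\<alpha> i - 1)) * (\<Prod>j\<in>UNIV - {i}. (x $ j) ^ \<alpha> j)) *\<^sub>R c \<alpha>)"
    for x h :: "real^'d"
  have "(p has_derivative p' x) (at x)" for x
    unfolding c p'_def
    by (intro has_derivative_sum has_derivative_scaleR_left has_derivative_prod has_derivative_power
        bounded_linear_imp_has_derivative bounded_linear_vec_nth)
  moreover have "continuous_on UNIV (\<lambda>x. p' x h)" for h
    unfolding p'_def by (intro continuous_intros)
  ultimately show ?thesis by (rule that)
qed

lemma poly_fun_differentiable: "p \<in> poly_fun m \<Longrightarrow> p differentiable (at x)"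
  for p :: "real^'d \<Rightarrow> 'b::real_normed_vector"
  by (metis poly_fun_C1 differentiableI)

lemma poly_fun_continuous: "p \<in> poly_fun m \<Longrightarrow> continuous_on UNIV p"
  for p :: "real^'d \<Rightarrow> 'b::real_normed_vector"
  by (simp add: continuous_at_imp_continuous_on differentiable_imp_continuous_within poly_fun_differentiable)

section \<open>Strains of polynomial fields\<close>

lemma continuous_eps_poly:
  assumes "p \<in> poly_fun m"
  shows "continuous_on UNIV (eps p)"
proof -
  obtain p' where p': "\<And>x. (p has_derivative p' x) (at x)" "\<And>h. continuous_on UNIV (\<lambda>x. p' x h)"
    using poly_fun_C1[OF assms] by metis
  have "frechet_derivative p (at x) = p' x" for x
    using frechet_derivative_at[OF p'(1)] by simp
  then have "eps p = (\<lambda>x. \<chi> i j. (1/2) * (p' x (axis j 1) $ i + p' x (axis i 1) $ j))"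
    by (simp add: fun_eq_iff eps_def grad_def jacobian_def matrix_def transpose_def vec_eq_iff)
  then show ?thesis
    using p'(2) by (simp add: continuous_on_vec_lambda continuous_intros)
qed

lemma eps_cong_open:
  assumes "p differentiable (at x)" "open U" "x \<in> U" "\<And>y. y \<in> U \<Longrightarrow> v y = p y"
  shows "eps v x = eps p x"
  using frechet_derivative_transform_within_open[OF assms(1-3), of v] assms(4)
  by (simp add: eps_def grad_def jacobian_def)

lemma eps_combine:
  assumes "p differentiable (at x)" "q differentiable (at x)"
  shows "eps (\<lambda>x. a *\<^sub>R p x + b *\<^sub>R q x) x = a *\<^sub>R eps p x + b *\<^sub>R eps q x"
proof -
  have "((\<lambda>x. a *\<^sub>R p x + b *\<^sub>R q x) has_derivative
      (\<lambda>h. a *\<^sub>R frechet_derivative p (at x) h + b *\<^sub>R frechet_derivative q (at x) h)) (at x)"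
    using assms by (intro derivative_intros) (simp_all flip: frechet_derivative_works)
  note D = frechet_derivative_at[OF this, symmetric]
  show ?thesis
    unfolding eps_def grad_def jacobian_def D
    by (simp add: matrix_def transpose_def vec_eq_iff algebra_simps)
qed

lemma inner_grad_eps: "h \<bullet> (grad v x *v h) = h \<bullet> (eps v x *v h)"
proof -
  have "h \<bullet> (transpose (grad v x) *v h) = h \<bullet> (grad v x *v h)"
    by (metis dot_lmul_matrix inner_commute transpose_matrix_vector)
  then show ?thesis
    by (simp add: eps_def scaleR_matrix_vector_assoc[symmetric] matrix_vector_mult_add_rdistrib inner_add_right)
qed

text \<open>Along the segment from \<open>y\<close> to \<open>x\<close> with direction \<open>h = x - y\<close>, the derivative of \<open>v \<bullet> h\<close> is
  \<open>h \<bullet> (grad v) h = h \<bullet> \<epsilon>(v) h = 0\<close>.\<close>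

lemma increment_orthogonal_if_eps_zero:
  fixes v :: "real^'d \<Rightarrow> real^'d"
  assumes U: "convex U" and diff: "\<And>z. z \<in> U \<Longrightarrow> v differentiable (at z)"
    and eps0: "\<And>z. z \<in> U \<Longrightarrow> eps v z = 0" and xy: "x \<in> U" "y \<in> U"
  shows "(v x - v y) \<bullet> (x - y) = 0"
proof -
  define h where "h = x - y"
  have mem: "y + t *\<^sub>R h \<in> U" if "0 \<le> t" "t \<le> 1" for t
    using convexD[OF U xy(2,1), of "1 - t" t] that by (simp add: h_def algebra_simps)
  have "((\<lambda>t. v (y + t *\<^sub>R h) \<bullet> h) has_real_derivative 0) (at t)" if t: "0 \<le> t" "t \<le> 1" for t
  proof -
    have "(v has_derivative (\<lambda>k. grad v (y + t *\<^sub>R h) *v k)) (at (y + t *\<^sub>R h))"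
      using diff[OF mem[OF t]] by (simp add: jacobian_works grad_def)
    moreover have "((\<lambda>t. y + t *\<^sub>R h) has_derivative (\<lambda>s. s *\<^sub>R h)) (at t)"
      by (auto intro!: derivative_eq_intros)
    ultimately have "((\<lambda>t. v (y + t *\<^sub>R h)) has_derivative (\<lambda>s. grad v (y + t *\<^sub>R h) *v (s *\<^sub>R h))) (at t)"
      using diff_chain_at[of "\<lambda>t. y + t *\<^sub>R h" _ t v] by (simp add: o_def)
    then have "((\<lambda>t. v (y + t *\<^sub>R h) \<bullet> h) has_derivative (\<lambda>s. (grad v (y + t *\<^sub>R h) *v (s *\<^sub>R h)) \<bullet> h)) (at t)"
      by (rule has_derivative_inner_left)
    moreover have "(grad v (y + t *\<^sub>R h) *v (s *\<^sub>R h)) \<bullet> h = 0" for s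
      using inner_grad_eps[of h v "y + t *\<^sub>R h"] eps0[OF mem[OF t]]
      by (simp add: matrix_vector_mult_scaleR inner_commute)
    ultimately show ?thesis by (simp add: has_field_derivative_def lambda_zero)
  qed
  from MVT2[of 0 1 "\<lambda>t. v (y + t *\<^sub>R h) \<bullet> h" "\<lambda>_. 0", OF _ this]
  have "v (y + h) \<bullet> h - v y \<bullet> h = 0" by auto
  then show ?thesis by (simp add: h_def inner_diff_left)
qed

text \<open>Polarizing the preceding lemma shows \<open>(v x - v a) \<bullet> (y - a) = - (v y - v a) \<bullet> (x - a)\<close>,
  and for fixed \<open>y\<close> the right-hand side is linear in \<open>x - a\<close>. Taking for \<open>y\<close> points displaced from \<open>a\<close> along the
  coordinate axes reads off every component of \<open>v x\<close>.\<close>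

lemma affine_if_eps_zero:
  fixes v :: "real^'d \<Rightarrow> real^'d"
  assumes U: "convex U" "open U" and diff: "\<And>z. z \<in> U \<Longrightarrow> v differentiable (at z)"
    and eps0: "\<And>z. z \<in> U \<Longrightarrow> eps v z = 0"
  obtains p where "p \<in> poly_fun 1" "\<And>x. x \<in> U \<Longrightarrow> v x = p x"
proof (cases "U = {}")
  case True
  then show ?thesis using that poly_fun_zero by blast
next
  case False
  then obtain a where a: "a \<in> U" by blast
  then obtain r where r: "r > 0" "ball a r \<subseteq> U"
    using U(2) open_contains_ball by blast
  define \<delta> where "\<delta> = r / 2"
  have \<delta>: "\<delta> > 0" using r by (simp add: \<delta>_def)
  have near: "a + \<delta> *\<^sub>R axis i 1 \<in> U" for i
    using r by (intro subsetD[OF r(2)]) (simp add: \<delta>_def dist_norm norm_axis_1)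
  have orth: "(v x - v y) \<bullet> (x - y) = 0" if "x \<in> U" "y \<in> U" for x y
    using increment_orthogonal_if_eps_zero[OF U(1) diff eps0 that] .
  have skew: "(v x - v a) \<bullet> (y - a) = - ((v y - v a) \<bullet> (x - a))" if "x \<in> U" "y \<in> U" for x y
    using orth[OF that] orth[OF that(1) a] orth[OF that(2) a]
    by (simp add: inner_simps inner_commute)
  define c where "c i = - (v (a + \<delta> *\<^sub>R axis i 1) - v a) /\<^sub>R \<delta>" for i
  have comp: "v x $ i = v a $ i + c i \<bullet> (x - a)" if "x \<in> U" for x i
  proof -
    have "c i \<bullet> (x - a) = - ((v (a + \<delta> *\<^sub>R axis i 1) - v a) \<bullet> (x - a)) / \<delta>"
      by (simp add: c_def inner_diff_left divide_inverse algebra_simps)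
    then have "\<delta> * (v x $ i - v a $ i) = \<delta> * (c i \<bullet> (x - a))"
      using skew[OF that near, of i] \<delta> by (simp add: inner_axis mult.commute)
    then show ?thesis using \<delta> by simp
  qed
  define b where "b = (\<chi> i. v a $ i - c i \<bullet> a)"
  define w where "w j = (\<chi> i. c i $ j)" for j
  have "v x = b + (\<Sum>j\<in>UNIV. x $ j *\<^sub>R w j)" if "x \<in> U" for x
    using comp[OF that] by (simp add: vec_eq_iff b_def w_def inner_vec_def right_diff_distrib
        sum_subtractf mult.commute)
  then show ?thesis using that poly_fun_affine by blast
qed

section \<open>The dual norm of the residual on orthogonal polynomials\<close>

text \<open>The scalar core of Pythagoras for a dual norm. In the application \<open>a = (r, \<epsilon> v)\<close>,
  \<open>b = (\<epsilon> e, \<epsilon> v)\<close>, \<open>N = \<parallel>\<epsilon> v\<parallel>\<^sup>2\<close>, \<open>E = \<parallel>\<epsilon> e\<parallel>\<^sup>2\<close>, where \<open>r\<close> is orthogonal to \<open>\<epsilon> e\<close>, and \<open>s\<close> is the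
  dual norm of \<open>r + \<epsilon> e\<close>; the first assumption is the bound that defines it,
  on the plane spanned by \<open>v\<close> and \<open>e\<close>. The conclusion bounds the dual norm of \<open>r\<close> by the root of \<open>s\<^sup>2 - E\<close>.\<close>

lemma pythagoras_from_plane_bound:
  fixes a b E N s :: real
  assumes bound: "\<And>\<alpha> \<beta>. \<alpha> * (a + b) + \<beta> * E \<le> s * sqrt (\<alpha>\<^sup>2 * N + 2 * \<alpha> * \<beta> * b + \<beta>\<^sup>2 * E)"
    and E: "E > 0" and N: "N \<ge> 0" and CS: "b\<^sup>2 \<le> N * E"
  shows "a\<^sup>2 \<le> (s\<^sup>2 - E) * N"
proof -
  have square: "Q\<^sup>2 \<le> s\<^sup>2 * X" if "Q \<le> s * sqrt X" "Q \<ge> 0" "X \<ge> 0" for Q X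
  proof -
    have "Q\<^sup>2 \<le> (s * sqrt X)\<^sup>2" using that by (intro power_mono)
    then show ?thesis using that by (simp add: power_mult_distrib)
  qed
  have "E\<^sup>2 \<le> s\<^sup>2 * E"
    using bound[of 0 1] E by (intro square) auto
  then have sE: "E \<le> s\<^sup>2" using E by (simp add: power2_eq_square)
  \<comment> \<open>\<open>v - t e\<close> is the part of \<open>v\<close> whose strain is orthogonal to \<open>\<epsilon> e\<close>, and \<open>D\<close> is the
    squared norm of that strain.\<close>
  define t where "t = b / E"
  have b: "b = t * E" using E by (simp add: t_def)
  define D where "D = N - t\<^sup>2 * E"
  have "(t\<^sup>2 * E) * E \<le> N * E" using CS by (simp add: b power2_eq_square algebra_simps)
  then have D: "D \<ge> 0" "D \<le> N" using E by (simp_all add: D_def)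
  define Q where "Q = a\<^sup>2 + D * E"
  have Q: "Q \<ge> 0" using D E by (simp add: Q_def)
  \<comment> \<open>The test field \<open>a (v - t e) + D e\<close> is, up to a factor, the direction in the plane that attains
    the dual norm.\<close>
  define \<beta> where "\<beta> = D - a * t"
  have "a * (a + b) + \<beta> * E = Q"
    by (simp add: \<beta>_def Q_def b algebra_simps power2_eq_square)
  moreover have "a\<^sup>2 * N + 2 * a * \<beta> * b + \<beta>\<^sup>2 * E = D * Q"
    by (simp add: \<beta>_def Q_def D_def b algebra_simps power2_eq_square)
  ultimately have "Q\<^sup>2 \<le> s\<^sup>2 * (D * Q)"
    using bound[of a \<beta>] D Q by (intro square) auto
  then have "Q * (s\<^sup>2 * D - Q) \<ge> 0" by (simp add: power2_eq_square algebra_simps)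
  then have "Q = 0 \<or> Q \<le> s\<^sup>2 * D" using Q by (auto simp: zero_le_mult_iff)
  moreover have "a\<^sup>2 \<le> Q" using D E by (simp add: Q_def)
  ultimately have "a\<^sup>2 \<le> (s\<^sup>2 - E) * D"
    using sE D mult_nonneg_nonneg[of "s\<^sup>2 - E" D] by (auto simp: Q_def algebra_simps)
  also have "\<dots> \<le> (s\<^sup>2 - E) * N" using D sE by (intro mult_left_mono) auto
  finally show ?thesis .
qed

definition orth_poly :: "nat \<Rightarrow> nat \<Rightarrow> (real^'d) set \<Rightarrow> (real^'d \<Rightarrow> real^'d) set" where
  "orth_poly n m U = {p\<in>poly_fun m. \<forall>q\<in>poly_fun n. L2_inner (lebesgue_on U) p q = 0}"

text \<open>The norm of the residual problem with the space of test fields as a parameter and with all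
  integrals taken over the open set \<open>U\<close>.\<close>

definition dual_norm ::
    "(real^'d \<Rightarrow> real^'d) set \<Rightarrow> (real^'d) set \<Rightarrow> (real^'d \<Rightarrow> real^'d^'d) \<Rightarrow> real" where
  "dual_norm W U r = (SUP v\<in>{v\<in>W. \<exists>x\<in>U. v x \<noteq> 0}.
     L2_inner (lebesgue_on U) r (eps v) / L2_norm (lebesgue_on U) (eps v))"

lemma poly_in_L2:
  fixes p :: "real^'d \<Rightarrow> 'b::euclidean_space"
  assumes "p \<in> poly_fun m" "open U" "bounded U"
  shows "p \<in> L2 (lebesgue_on U)"
  using assms by (intro continuous_in_L2 poly_fun_continuous) auto

lemma eps_poly_in_L2:
  assumes "p \<in> poly_fun m" "open U" "bounded U"
  shows "eps p \<in> L2 (lebesgue_on U)"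
  using assms by (intro continuous_in_L2 continuous_eps_poly) auto

lemma orth_poly_combine:
  assumes "p \<in> orth_poly n m U" "q \<in> orth_poly n m U" "open U" "bounded U"
  shows "(\<lambda>x. a *\<^sub>R p x + b *\<^sub>R q x) \<in> orth_poly n m U"
  using assms
  by (auto simp: orth_poly_def L2_inner_combine_left[OF poly_in_L2 poly_in_L2 poly_in_L2]
      intro: poly_fun_combine)

text \<open>Orthogonality to the affine fields excludes all nonzero infinitesimal rigid motions, so that
  \<open>v \<mapsto> \<parallel>\<epsilon> v\<parallel>\<close> is a norm on this space; in particular the quotients in the dual norm have nonzero
  denominators.\<close>

lemma eps_definite_on_orth_poly:
  assumes U: "convex U" "open U" "bounded U" and "1 \<le> n"
    and v: "v \<in> orth_poly n m U" and zero: "L2_inner (lebesgue_on U) (eps v) (eps v) = 0"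
    and x: "x \<in> U"
  shows "v x = 0"
proof -
  have vm: "v \<in> poly_fun m" using v by (simp add: orth_poly_def)
  have "eps v z = 0" if "z \<in> U" for z
    using continuous_L2_definite[OF continuous_eps_poly[OF vm] U(2,3) zero that] .
  then obtain p where p: "p \<in> poly_fun 1" "\<And>z. z \<in> U \<Longrightarrow> v z = p z"
    using affine_if_eps_zero[OF U(1,2) poly_fun_differentiable[OF vm]] by metis
  have "L2_inner (lebesgue_on U) v v = L2_inner (lebesgue_on U) v p"
    using p(2) by (intro L2_inner_cong) auto
  also have "\<dots> = 0"
    using v poly_fun_mono[OF p(1) \<open>1 \<le> n\<close>] by (simp add: orth_poly_def)
  finally show ?thesis
    using continuous_L2_definite[OF poly_fun_continuous[OF vm] U(2,3)] x by blast
qed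

text \<open>Every test field \<open>v\<close> in the dual norm of \<open>r\<close> is treated separately. Since \<open>r\<close> is orthogonal to
  \<open>\<epsilon> e\<close>, only the part of \<open>\<epsilon> v\<close> orthogonal to \<open>\<epsilon> e\<close> contributes to \<open>(r, \<epsilon> v)\<close>, and tilting this part
  towards \<open>e\<close> gives a test field for \<open>r + \<epsilon> e\<close> that picks up both contributions.\<close>

lemma dual_norm_pythagoras:
  assumes U: "convex U" "open U" "bounded U" and "1 \<le> n"
    and r: "r \<in> L2 (lebesgue_on U)"
    and e: "e \<in> orth_poly n m U" "\<exists>x\<in>U. e x \<noteq> 0"
    and orth: "L2_inner (lebesgue_on U) r (eps e) = 0"
  shows "(dual_norm (orth_poly n m U) U r)\<^sup>2 + L2_inner (lebesgue_on U) (eps e) (eps e)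
    \<le> (dual_norm (orth_poly n m U) U (\<lambda>x. r x + eps e x))\<^sup>2"
    and "0 < L2_inner (lebesgue_on U) (eps e) (eps e)"
proof -
  let ?ip = "L2_inner (lebesgue_on U)" and ?W = "orth_poly n m U"
  define V where "V = {v\<in>?W. \<exists>x\<in>U. v x \<noteq> 0}"
  define r' where "r' = (\<lambda>x. r x + eps e x)"
  define E where "E = ?ip (eps e) (eps e)"
  define s where "s = dual_norm ?W U r'"
  have W_poly: "v \<in> poly_fun m" if "v \<in> ?W" for v using that by (simp add: orth_poly_def)
  have epsL2: "eps v \<in> L2 (lebesgue_on U)" if "v \<in> ?W" for v
    using eps_poly_in_L2[OF W_poly[OF that] U(2,3)] .
  have r': "r' \<in> L2 (lebesgue_on U)"
    using L2_combine[OF r epsL2[OF e(1)], of 1 1] by (simp add: r'_def)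
  have pos: "0 < ?ip (eps v) (eps v)" if "v \<in> V" for v
    using eps_definite_on_orth_poly[OF U \<open>1 \<le> n\<close>, of v m] that L2_inner_self_nonneg[of _ "eps v"]
    by (force simp: V_def order_less_le)
  have eV: "e \<in> V" using e by (simp add: V_def)
  show E: "0 < ?ip (eps e) (eps e)" by (rule pos[OF eV])
  have r'_ip: "?ip r' (eps v) = ?ip r (eps v) + ?ip (eps e) (eps v)" if "v \<in> ?W" for v
    using L2_inner_combine_left[OF epsL2[OF that] r epsL2[OF e(1)], of 1 1] by (simp add: r'_def)
  have quot: "\<bar>?ip t (eps v) / L2_norm (lebesgue_on U) (eps v)\<bar> \<le> L2_norm (lebesgue_on U) t"
    if "v \<in> V" "t \<in> L2 (lebesgue_on U)" for v t
  proof -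
    have "sqrt ((?ip t (eps v))\<^sup>2) \<le> sqrt (?ip t t * ?ip (eps v) (eps v))"
      using that epsL2 by (intro real_sqrt_le_mono L2_Cauchy_Schwarz) (simp_all add: V_def)
    then have "\<bar>?ip t (eps v)\<bar> \<le> L2_norm (lebesgue_on U) t * L2_norm (lebesgue_on U) (eps v)"
      by (simp add: L2_norm_def real_sqrt_mult)
    then show ?thesis
      using pos[OF that(1)] by (simp add: L2_norm_def field_simps)
  qed
  have bdd: "bdd_above ((\<lambda>v. ?ip t (eps v) / L2_norm (lebesgue_on U) (eps v)) ` V)"
    if "t \<in> L2 (lebesgue_on U)" for t
    using quot[OF _ that] by (intro bdd_aboveI2[where M = "L2_norm (lebesgue_on U) t"]) (meson abs_le_D1)
  \<comment> \<open>Combinations of \<open>v\<close> and \<open>e\<close> may vanish on \<open>U\<close>, so the bound that defines \<open>s\<close> is stated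
    without division and for all members of the space.\<close>
  have le_s: "?ip r' (eps v) \<le> s * sqrt (?ip (eps v) (eps v))" if "v \<in> ?W" for v
  proof (cases "v \<in> V")
    case True
    then have "?ip r' (eps v) / L2_norm (lebesgue_on U) (eps v) \<le> s"
      unfolding s_def dual_norm_def V_def[symmetric] by (intro cSUP_upper bdd[OF r'])
    then show ?thesis using pos[OF True] by (simp add: L2_norm_def field_simps)
  next
    case False
    then have v0: "v x = 0" if "x \<in> U" for x using that \<open>v \<in> ?W\<close> by (auto simp: V_def)
    have "eps v x = 0" if "x \<in> U" for x
    proof -
      have "eps v x = eps (\<lambda>_. 0) x"
        using v0 that U(2) by (intro eps_cong_open[of _ _ U]) auto
      also have "\<dots> = 0"
        by (simp add: eps_def grad_def jacobian_def matrix_def transpose_def vec_eq_iff)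
      finally show ?thesis .
    qed
    then have "?ip t (eps v) = 0" for t
      using L2_inner_cong[of "lebesgue_on U" t t "eps v" "\<lambda>_. 0"] by (simp add: L2_inner_def)
    then show ?thesis by simp
  qed
  have key: "(?ip r (eps v))\<^sup>2 \<le> (s\<^sup>2 - E) * ?ip (eps v) (eps v)" if "v \<in> V" for v
  proof (rule pythagoras_from_plane_bound[where b = "?ip (eps v) (eps e)"])
    have v: "v \<in> ?W" using that by (simp add: V_def)
    fix \<alpha> \<beta> :: real
    let ?z = "\<lambda>x. \<alpha> *\<^sub>R v x + \<beta> *\<^sub>R e x"
    have z: "?z \<in> ?W" using orth_poly_combine[OF v e(1) U(2,3)] .
    have eps_z: "eps ?z = (\<lambda>x. \<alpha> *\<^sub>R eps v x + \<beta> *\<^sub>R eps e x)"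
      using poly_fun_differentiable[OF W_poly] v e(1) by (intro ext eps_combine) auto
    have "?ip r' (eps ?z) = \<alpha> * ?ip r' (eps v) + \<beta> * ?ip r' (eps e)"
      unfolding eps_z by (rule L2_inner_combine_right[OF r' epsL2[OF v] epsL2[OF e(1)]])
    also have "\<dots> = \<alpha> * (?ip r (eps v) + ?ip (eps v) (eps e)) + \<beta> * E"
      using r'_ip[OF v] r'_ip[OF e(1)] orth by (simp add: E_def L2_inner_commute[of _ "eps e" "eps v"] algebra_simps)
    finally show "\<alpha> * (?ip r (eps v) + ?ip (eps v) (eps e)) + \<beta> * E
      \<le> s * sqrt (\<alpha>\<^sup>2 * ?ip (eps v) (eps v) + 2 * \<alpha> * \<beta> * ?ip (eps v) (eps e) + \<beta>\<^sup>2 * E)"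
      using le_s[OF z] L2_inner_combine_self[OF epsL2[OF v] epsL2[OF e(1)], of \<alpha> \<beta>]
      by (simp add: eps_z E_def)
  next
    show "E > 0" using E by (simp add: E_def)
    show "?ip (eps v) (eps v) \<ge> 0" by (rule L2_inner_self_nonneg)
    show "(?ip (eps v) (eps e))\<^sup>2 \<le> ?ip (eps v) (eps v) * E"
      unfolding E_def using that by (intro L2_Cauchy_Schwarz epsL2 e) (simp add: V_def)
  qed
  have "0 \<le> (s\<^sup>2 - E) * E" using key[OF eV] orth by (simp add: E_def)
  then have sE: "0 \<le> s\<^sup>2 - E" using E by (simp add: E_def zero_le_mult_iff)
  have "dual_norm ?W U r \<le> sqrt (s\<^sup>2 - E)"
    unfolding dual_norm_def V_def[symmetric]
  proof (rule cSUP_least)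
    show "V \<noteq> {}" using eV by blast
    fix v assume v: "v \<in> V"
    have "\<bar>?ip r (eps v)\<bar> \<le> sqrt (s\<^sup>2 - E) * L2_norm (lebesgue_on U) (eps v)"
      using real_sqrt_le_mono[OF key[OF v]] by (simp add: L2_norm_def real_sqrt_mult)
    then show "?ip r (eps v) / L2_norm (lebesgue_on U) (eps v) \<le> sqrt (s\<^sup>2 - E)"
      using pos[OF v] by (simp add: L2_norm_def field_simps)
  qed
  moreover have "0 \<le> dual_norm ?W U r"
  proof -
    have "?ip r (eps e) / L2_norm (lebesgue_on U) (eps e) \<le> dual_norm ?W U r"
      unfolding dual_norm_def V_def[symmetric] by (rule cSUP_upper[OF eV bdd[OF r]])
    then show ?thesis by (simp add: orth)
  qed
  ultimately have "(dual_norm ?W U r)\<^sup>2 \<le> (sqrt (s\<^sup>2 - E))\<^sup>2"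
    by (intro power_mono)
  then show "(dual_norm ?W U r)\<^sup>2 + ?ip (eps e) (eps e) \<le> (dual_norm ?W U (\<lambda>x. r x + eps e x))\<^sup>2"
    using sE by (simp add: s_def E_def r'_def)
qed

section \<open>Localization to one element\<close>

text \<open>A polynomial on one element becomes a global piecewise polynomial field by extension by zero;
  this makes the global projection local.\<close>

definition cutoff :: "'a set \<Rightarrow> ('a \<Rightarrow> 'b::zero) \<Rightarrow> 'a \<Rightarrow> 'b" where
  "cutoff U q x = (if x \<in> U then q x else 0)"

lemma L2_inner_cutoff:
  fixes u :: "'a::euclidean_space \<Rightarrow> 'b::euclidean_space"
  assumes "U \<subseteq> \<Omega>" "U \<in> sets lebesgue" "\<Omega> \<in> sets lebesgue"
  shows "L2_inner (lebesgue_on \<Omega>) u (cutoff U q) = L2_inner (lebesgue_on U) u q"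
proof -
  have "(\<lambda>x. u x \<bullet> cutoff U q x) = (\<lambda>x. if x \<in> U then u x \<bullet> q x else 0)"
    by (auto simp: cutoff_def)
  then show ?thesis
    by (simp add: L2_inner_def Lebesgue_Measure.integral_restrict assms)
qed

lemma cutoff_in_L2:
  fixes q :: "'a::euclidean_space \<Rightarrow> 'b::euclidean_space"
  assumes q: "q \<in> L2 (lebesgue_on U)" and "U \<subseteq> \<Omega>" "U \<in> sets lebesgue" "\<Omega> \<in> sets lebesgue"
  shows "cutoff U q \<in> L2 (lebesgue_on \<Omega>)"
proof -
  have "cutoff U q \<in> borel_measurable (lebesgue_on \<Omega>)"
    using q assms borel_measurable_if_lebesgue_on[of U \<Omega> q]
    by (simp add: L2_def cutoff_def[abs_def])
  moreover have "indicator \<Omega> x *\<^sub>R (norm (cutoff U q x))\<^sup>2 = indicator U x *\<^sub>R (norm (q x))\<^sup>2" for x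
    using \<open>U \<subseteq> \<Omega>\<close> by (auto simp: cutoff_def indicator_def)
  ultimately show ?thesis
    using q assms(3,4) by (simp add: L2_def integrable_restrict_space)
qed

lemma mesh_element:
  fixes K :: "(real^'d) set"
  assumes "simplicial_mesh \<Omega> \<T>" "K \<in> \<T>"
  shows "convex K" "closed K" "bounded (interior K)"
proof -
  have K: "int CARD('d) simplex K" using assms by (simp add: simplicial_mesh_def)
  show "convex K" "closed K" using convex_simplex[OF K] closed_simplex[OF K] by simp_all
  show "bounded (interior K)"
    using compact_imp_bounded[OF compact_simplex[OF K]] by (rule bounded_subset[OF _ interior_subset])
qed

text \<open>An element is only a subset of the closure of the domain. Its interior lies in the domain
  itself, as a polyhedral domain is the interior of its closure (it has no slits).\<close>

lemma mesh_interior_subset: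
  assumes "polyhedral_domain \<Omega>" "simplicial_mesh \<Omega> \<T>" "K \<in> \<T>"
  shows "interior K \<subseteq> \<Omega>"
proof -
  have "K \<subseteq> closure \<Omega>" using assms by (auto simp: simplicial_mesh_def)
  then show ?thesis
    using assms(1) interior_mono unfolding polyhedral_domain_def by blast
qed

text \<open>The intersection of two elements is a face of both, and a proper face contains no interior
  points.\<close>

lemma mesh_interiors_disjoint:
  assumes "simplicial_mesh \<Omega> \<T>" "K \<in> \<T>" "L \<in> \<T>" "K \<noteq> L"
  shows "interior K \<inter> interior L = {}"
proof -
  have "K \<inter> L face_of K" "L \<inter> K face_of L"
    using assms unfolding simplicial_mesh_def triangulation_def by blast+
  then have "K \<inter> L = K \<or> K \<inter> L \<inter> interior K = {}" "L \<inter> K = L \<or> L \<inter> K \<inter> interior L = {}"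
    using face_of_disjoint_interior by metis+
  then show ?thesis
    using \<open>K \<noteq> L\<close> interior_subset[of K] interior_subset[of L] by blast
qed

lemma mesh_covers_AE:
  assumes "polyhedral_domain \<Omega>" and mesh: "simplicial_mesh \<Omega> \<T>"
  shows "AE x in lebesgue_on \<Omega>. \<exists>K\<in>\<T>. x \<in> interior K"
proof -
  have "finite \<T>" using mesh by (simp add: simplicial_mesh_def triangulation_def)
  then have "negligible (\<Union>(frontier ` \<T>))"
    using mesh_element(1)[OF mesh] negligible_convex_frontier by (intro negligible_Union) auto
  then have "AE x in lebesgue. x \<notin> \<Union>(frontier ` \<T>)"
    unfolding negligible_iff_null_sets by (rule AE_not_in)
  then have "AE x in lebesgue. x \<in> \<Omega> \<longrightarrow> (\<exists>K\<in>\<T>. x \<in> interior K)"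
  proof (rule eventually_mono, intro impI)
    fix x assume x: "x \<notin> \<Union>(frontier ` \<T>)" "x \<in> \<Omega>"
    then have "x \<in> \<Union>\<T>"
      using mesh closure_subset unfolding simplicial_mesh_def by blast
    then obtain K where "K \<in> \<T>" "x \<in> K" by blast
    then show "\<exists>K\<in>\<T>. x \<in> interior K"
      using x closure_subset[of K] by (auto simp: frontier_def)
  qed
  moreover have "\<Omega> \<in> sets lebesgue"
    using assms(1) by (simp add: polyhedral_domain_def)
  ultimately show ?thesis by (simp add: AE_restrict_space_iff)
qed

lemma cutoff_in_V_pw:
  assumes dom: "polyhedral_domain \<Omega>" "simplicial_mesh \<Omega> \<T>" "K \<in> \<T>" and q: "q \<in> poly_fun m"
  shows "cutoff (interior K) q \<in> V_pw \<Omega> \<T> m"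
proof -
  have "\<Omega> \<in> sets lebesgue" using dom(1) by (simp add: polyhedral_domain_def)
  then have "cutoff (interior K) q \<in> L2 (lebesgue_on \<Omega>)"
    using poly_in_L2[OF q] mesh_element(3)[OF dom(2,3)] mesh_interior_subset[OF dom]
    by (intro cutoff_in_L2) auto
  moreover have "cutoff (interior K) q \<in> V_loc m L" if "L \<in> \<T>" for L
  proof (cases "L = K")
    case True
    then show ?thesis using q by (auto simp: V_loc_def cutoff_def)
  next
    case False
    then have "cutoff (interior K) q x = 0" if "x \<in> interior L" for x
      using mesh_interiors_disjoint[OF dom(2,3) \<open>L \<in> \<T>\<close>] that by (auto simp: cutoff_def)
    then show ?thesis by (auto simp: V_loc_def intro: bexI[OF _ poly_fun_zero])
  qed
  ultimately show ?thesis by (simp add: V_pw_def)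
qed

lemma restrictionsI:
  "v \<in> X \<Longrightarrow> (\<And>x. x \<in> interior K \<Longrightarrow> w x = v x) \<Longrightarrow> w \<in> restrictions K X"
  unfolding restrictions_def by blast

lemma cutoff_in_Ph_V:
  assumes dom: "polyhedral_domain \<Omega>" "simplicial_mesh \<Omega> \<T>" "K \<in> \<T>"
    and q: "q \<in> poly_fun (disp_degree fam k)" and "disp_degree fam k \<le> m"
  shows "cutoff (interior K) q \<in> Ph_V fam k \<Omega> \<T> m"
proof -
  have "cutoff (interior K) q \<in> V_pw \<Omega> \<T> m"
    by (rule cutoff_in_V_pw[OF dom poly_fun_mono[OF q assms(5)]])
  moreover have "is_L2_projection (lebesgue_on \<Omega>) (V_h fam k \<Omega> \<T>)
      (cutoff (interior K) q) (cutoff (interior K) q)"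
    using cutoff_in_V_pw[OF dom q] by (simp add: is_L2_projection_def V_h_def L2_inner_def)
  ultimately show ?thesis unfolding Ph_V_def by blast
qed

text \<open>The global projection acts element by element. A difference of a field and its projection is
  orthogonal to the cutoffs of all polynomials on \<open>K\<close> of the lower degree. Conversely the cutoff of a
  polynomial that is orthogonal on \<open>K\<close> to those of lower degree has projection \<open>0\<close>.\<close>

lemma restrictions_I_minus_Ph_V:
  assumes dom: "polyhedral_domain \<Omega>" "simplicial_mesh \<Omega> \<T>" "K \<in> \<T>" and deg: "disp_degree fam k \<le> m"
  shows "restrictions K (I_minus_Ph_V fam k \<Omega> \<T> m)
    = {w. \<exists>p\<in>orth_poly (disp_degree fam k) m (interior K). \<forall>x\<in>interior K. w x = p x}"
proof (intro equalityI subsetI)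
  let ?n = "disp_degree fam k" and ?U = "interior K"
  have meas: "?U \<in> sets lebesgue" "\<Omega> \<in> sets lebesgue" "?U \<subseteq> \<Omega>"
    using dom(1) mesh_interior_subset[OF dom] by (auto simp: polyhedral_domain_def)
  fix w
  {
    assume "w \<in> restrictions K (I_minus_Ph_V fam k \<Omega> \<T> m)"
    then obtain v p where v: "v \<in> V_pw \<Omega> \<T> m"
      and p: "is_L2_projection (lebesgue_on \<Omega>) (V_h fam k \<Omega> \<T>) v p"
      and w: "\<And>x. x \<in> ?U \<Longrightarrow> w x = v x - p x"
      unfolding restrictions_def I_minus_Ph_V_def by blast
    obtain v' where v': "v' \<in> poly_fun m" "\<And>x. x \<in> ?U \<Longrightarrow> v x = v' x"
      using v dom(3) by (auto simp: V_pw_def V_loc_def)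
    obtain p' where p': "p' \<in> poly_fun ?n" "\<And>x. x \<in> ?U \<Longrightarrow> p x = p' x"
      using p dom(3) by (auto simp: is_L2_projection_def V_h_def V_pw_def V_loc_def)
    define d where "d = (\<lambda>x. v' x - p' x)"
    have "d \<in> poly_fun m"
      using poly_fun_combine[OF v'(1) poly_fun_mono[OF p'(1) deg], of 1 "-1"] by (simp add: d_def)
    moreover have "L2_inner (lebesgue_on ?U) d q = 0" if "q \<in> poly_fun ?n" for q
    proof -
      have "L2_inner (lebesgue_on ?U) d q = L2_inner (lebesgue_on ?U) (\<lambda>x. v x - p x) q"
        by (rule L2_inner_cong) (simp_all add: d_def v'(2) p'(2))
      also have "\<dots> = L2_inner (lebesgue_on \<Omega>) (\<lambda>x. v x - p x) (cutoff ?U q)"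
        by (simp add: L2_inner_cutoff meas)
      also have "\<dots> = 0"
        using p cutoff_in_V_pw[OF dom that] by (simp add: is_L2_projection_def V_h_def)
      finally show ?thesis .
    qed
    ultimately have "d \<in> orth_poly ?n m ?U" by (simp add: orth_poly_def)
    then show "w \<in> {w. \<exists>p\<in>orth_poly ?n m ?U. \<forall>x\<in>?U. w x = p x}"
      using w v'(2) p'(2) by (auto simp: d_def intro!: bexI[of _ d])
  next
    assume "w \<in> {w. \<exists>p\<in>orth_poly ?n m ?U. \<forall>x\<in>?U. w x = p x}"
    then obtain p where p: "p \<in> poly_fun m" "\<And>q. q \<in> poly_fun ?n \<Longrightarrow> L2_inner (lebesgue_on ?U) p q = 0"
      and w: "\<And>x. x \<in> ?U \<Longrightarrow> w x = p x"
      by (auto simp: orth_poly_def)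
    have "(\<lambda>x. 0) \<in> V_h fam k \<Omega> \<T>"
      by (auto simp: V_h_def V_pw_def V_loc_def L2_def intro: bexI[OF _ poly_fun_zero])
    moreover have "L2_inner (lebesgue_on \<Omega>) (\<lambda>x. cutoff ?U p x - 0) q = 0" if q: "q \<in> V_h fam k \<Omega> \<T>" for q
    proof -
      obtain q' where q': "q' \<in> poly_fun ?n" "\<And>x. x \<in> ?U \<Longrightarrow> q x = q' x"
        using q dom(3) by (auto simp: V_h_def V_pw_def V_loc_def)
      have "L2_inner (lebesgue_on \<Omega>) (cutoff ?U p) q = L2_inner (lebesgue_on ?U) p q"
        using L2_inner_cutoff[OF meas(3,1,2)] by (metis L2_inner_commute)
      also have "\<dots> = L2_inner (lebesgue_on ?U) p q'"
        by (rule L2_inner_cong) (simp_all add: q'(2))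
      also have "\<dots> = 0" by (rule p(2)[OF q'(1)])
      finally show ?thesis by simp
    qed
    ultimately have "is_L2_projection (lebesgue_on \<Omega>) (V_h fam k \<Omega> \<T>) (cutoff ?U p) (\<lambda>x. 0)"
      by (simp add: is_L2_projection_def)
    then have "(\<lambda>x. cutoff ?U p x - 0) \<in> I_minus_Ph_V fam k \<Omega> \<T> m"
      using cutoff_in_V_pw[OF dom p(1)] unfolding I_minus_Ph_V_def
      by (intro CollectI exI[of _ "cutoff ?U p"] exI[of _ "\<lambda>x. 0"] conjI refl)
    then show "w \<in> restrictions K (I_minus_Ph_V fam k \<Omega> \<T> m)"
      by (rule restrictionsI) (simp add: w cutoff_def)
  }
qed

lemma L2_inner_eps_interior:
  assumes "convex K" "closed K" "p \<in> poly_fun m" "\<And>x. x \<in> interior K \<Longrightarrow> v x = p x"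
    and "\<And>x. x \<in> interior K \<Longrightarrow> r x = r' x"
  shows "L2_inner (lebesgue_on K) r (eps v) = L2_inner (lebesgue_on (interior K)) r' (eps p)"
proof -
  have "eps v x = eps p x" if "x \<in> interior K" for x
    using assms(3,4) that poly_fun_differentiable by (intro eps_cong_open[of _ _ "interior K"]) auto
  then show ?thesis
    unfolding L2_inner_interior[OF assms(1,2)] using assms(5) by (intro L2_inner_cong) auto
qed

lemma L2_norm_eps_interior:
  assumes "convex K" "closed K" "p \<in> poly_fun m" "\<And>x. x \<in> interior K \<Longrightarrow> v x = p x"
  shows "L2_norm (lebesgue_on K) (eps v) = L2_norm (lebesgue_on (interior K)) (eps p)"
proof -
  have "eps v x = eps p x" if "x \<in> interior K" for x
    using assms(3,4) that poly_fun_differentiable by (intro eps_cong_open[of _ _ "interior K"]) auto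
  then show ?thesis
    unfolding L2_norm_def using L2_inner_eps_interior[OF assms, of "eps v" "eps p"] by simp
qed

text \<open>Every quotient in the supremum depends only on the values in the interior of the element, where
  the test field may be replaced by its polynomial.\<close>

lemma star_norm_eq_dual_norm:
  assumes dom: "polyhedral_domain \<Omega>" "simplicial_mesh \<Omega> \<T>" "K \<in> \<T>"
    and deg: "disp_degree fam k \<le> post_degree fam k + 1"
    and r: "\<And>x. x \<in> interior K \<Longrightarrow> r x = r' x"
  shows "star_norm fam k \<Omega> \<T> K r
    = dual_norm (orth_poly (disp_degree fam k) (post_degree fam k + 1) (interior K)) (interior K) r'"
proof -
  let ?W = "orth_poly (disp_degree fam k) (post_degree fam k + 1) (interior K)"
  let ?F = "\<lambda>v. L2_inner (lebesgue_on K) r (eps v) / L2_norm (lebesgue_on K) (eps v)"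
  let ?G = "\<lambda>v. L2_inner (lebesgue_on (interior K)) r' (eps v) / L2_norm (lebesgue_on (interior K)) (eps v)"
  note K = mesh_element(1,2)[OF dom(2,3)]
  have FG: "?F v = ?G p" if "p \<in> ?W" "\<forall>x\<in>interior K. v x = p x" for v p
  proof -
    have p: "p \<in> poly_fun (post_degree fam k + 1)" using that(1) by (simp add: orth_poly_def)
    show ?thesis
      using L2_inner_eps_interior[OF K p, of v r r'] L2_norm_eps_interior[OF K p, of v] that(2) r
      by simp
  qed
  have "?F ` {v. (\<exists>p\<in>?W. \<forall>x\<in>interior K. v x = p x) \<and> (\<exists>x\<in>interior K. v x \<noteq> 0)}
      = ?G ` {v\<in>?W. \<exists>x\<in>interior K. v x \<noteq> 0}" (is "?F ` ?A = ?G ` ?B")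
  proof (intro equalityI subsetI)
    fix y assume "y \<in> ?F ` ?A"
    then obtain v p where "p \<in> ?W" "\<forall>x\<in>interior K. v x = p x" "\<exists>x\<in>interior K. v x \<noteq> 0" "y = ?F v"
      by blast
    then show "y \<in> ?G ` ?B" using FG by (intro image_eqI[of _ _ p]) auto
  next
    fix y assume "y \<in> ?G ` ?B"
    then obtain p where "p \<in> ?W" "\<exists>x\<in>interior K. p x \<noteq> 0" "y = ?G p" by blast
    then show "y \<in> ?F ` ?A" using FG[of p p] by (intro image_eqI[of _ _ p]) auto
  qed
  then show ?thesis
    unfolding star_norm_def dual_norm_def restrictions_I_minus_Ph_V[OF dom deg] by (simp only: mem_Collect_eq)
qed

section \<open>The two postprocessed fields coincide\<close>

theorem proposition3p1:
  fixes \<Omega> \<Gamma>\<^sub>D \<Gamma>\<^sub>N :: "(real^'d) set"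
    and \<T> :: "(real^'d) set set"
    and fam :: element_family and k :: nat
    and S :: "(real^'d) set \<Rightarrow> (real^'d \<Rightarrow> real^'d^'d) set"
    and \<mu> lam :: real
    and f g u\<^sub>h u\<^sub>t w\<^sub>h :: "real^'d \<Rightarrow> real^'d"
    and \<sigma>\<^sub>h :: "real^'d \<Rightarrow> real^'d^'d"
  assumes "CARD('d) \<in> {2, 3}"
    and "polyhedral_domain \<Omega>"
    and "simplicial_mesh \<Omega> \<T>"
    and "boundary_splitting \<Omega> \<T> \<Gamma>\<^sub>D \<Gamma>\<^sub>N"
    and "\<mu> > 0" and "lam > 0"
    and "f \<in> L2 (lebesgue_on \<Omega>)"
    and "\<forall>E\<in>boundary_faces \<Omega> \<T>. rel_interior E \<subseteq> \<Gamma>\<^sub>N \<longrightarrow> g \<in> L2 (face_measure E)"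
    and "stress_family fam k \<Omega> \<T> S"
    and solution: "discrete_solution \<mu> lam fam k \<Omega> \<Gamma>\<^sub>N \<T> S f g \<sigma>\<^sub>h u\<^sub>h"
    and post: "u\<^sub>t \<in> V_pw \<Omega> \<T> (post_degree fam k)"
      "\<forall>K\<in>\<T>. \<forall>v\<in>restrictions K (I_minus_Ph_V fam k \<Omega> \<T> (post_degree fam k)).
         L2_inner (lebesgue_on K) (eps u\<^sub>t) (eps v)
         = L2_inner (lebesgue_on K) (\<lambda>x. compliance \<mu> lam (\<sigma>\<^sub>h x)) (eps v)"
      "\<forall>K\<in>\<T>. \<forall>v\<in>restrictions K (Ph_V fam k \<Omega> \<T> (post_degree fam k)).
         L2_inner (lebesgue_on K) u\<^sub>t v = L2_inner (lebesgue_on K) u\<^sub>h v"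
    and minimizer: "w\<^sub>h \<in> V_pw \<Omega> \<T> (post_degree fam k)"
      "\<forall>K\<in>\<T>. is_arg_min
         (\<lambda>v. 1/2 * (star_norm fam k \<Omega> \<T> K (\<lambda>x. compliance \<mu> lam (\<sigma>\<^sub>h x) - eps v x))\<^sup>2)
         (\<lambda>v. v \<in> V_loc (post_degree fam k) K \<and>
              (\<forall>v\<^sub>K\<in>restrictions K (Ph_V fam k \<Omega> \<T> (post_degree fam k)).
                 L2_inner (lebesgue_on K) v v\<^sub>K = L2_inner (lebesgue_on K) u\<^sub>h v\<^sub>K))
         w\<^sub>h"
  shows "AE x in lebesgue_on \<Omega>. w\<^sub>h x = u\<^sub>t x"
proof -
  define n l where "n = disp_degree fam k" and "l = post_degree fam k"
  define \<tau> where "\<tau> = (\<lambda>x. compliance \<mu> lam (\<sigma>\<^sub>h x))"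
  note dom = \<open>polyhedral_domain \<Omega>\<close> \<open>simplicial_mesh \<Omega> \<T>\<close>
  have n1: "1 \<le> n" and nl: "n \<le> l"
    using \<open>stress_family fam k \<Omega> \<T> S\<close>
    by (auto simp: n_def l_def disp_degree_def post_degree_def stress_family_def split: if_splits)
  have \<tau>: "\<tau> \<in> L2 (lebesgue_on \<Omega>)"
    unfolding \<tau>_def using solution
    by (intro L2_linear_image[OF linear_compliance])
      (simp add: discrete_solution_def S_h_g_def S_h_def Hdiv_def)
  have "w\<^sub>h x = u\<^sub>t x" if K: "K \<in> \<T>" and x: "x \<in> interior K" for K x
  proof -
    let ?U = "interior K"
    let ?ip = "L2_inner (lebesgue_on ?U)"
    note conv = mesh_element(1,2)[OF dom(2) K]
    have U: "convex ?U" "open ?U" "bounded ?U"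
      using conv mesh_element(3)[OF dom(2) K] by (auto intro: convex_interior)
    obtain p where p: "p \<in> poly_fun l" "\<And>y. y \<in> ?U \<Longrightarrow> u\<^sub>t y = p y"
      using post(1) K by (auto simp: V_pw_def V_loc_def l_def)
    obtain q where q: "q \<in> poly_fun l" "\<And>y. y \<in> ?U \<Longrightarrow> w\<^sub>h y = q y"
      using minimizer(1) K by (auto simp: V_pw_def V_loc_def l_def)
    define e where "e = (\<lambda>y. p y - q y)"
    have e_poly: "e \<in> poly_fun l"
      using poly_fun_combine[OF p(1) q(1), of 1 "-1"] by (simp add: e_def)
    have eps_e: "eps e y = eps p y - eps q y" for y
      using eps_combine[OF poly_fun_differentiable[OF p(1)] poly_fun_differentiable[OF q(1)], of 1 "-1"]
      by (simp add: e_def)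
    have eps_u: "eps u\<^sub>t y = eps p y" and eps_w: "eps w\<^sub>h y = eps q y" if "y \<in> ?U" for y
      using that p q U(2) poly_fun_differentiable by (auto intro!: eps_cong_open[of _ _ ?U])

    \<comment> \<open>Both fields satisfy the same moment conditions, hence \<open>e\<close> is orthogonal to the displacement
      polynomials.\<close>
    note arg_min = minimizer(2)[rule_format, OF K, unfolded is_arg_min_def]
    have e_orth: "?ip e v = 0" if v: "v \<in> poly_fun n" for v
    proof -
      have "cutoff ?U v \<in> Ph_V fam k \<Omega> \<T> l"
        using cutoff_in_Ph_V[OF dom K] v nl by (simp add: n_def)
      then have v_Ph: "v \<in> restrictions K (Ph_V fam k \<Omega> \<T> l)"
        by (rule restrictionsI) (simp add: cutoff_def)
      have "?ip p v = ?ip u\<^sub>t v" "?ip q v = ?ip w\<^sub>h v"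
        using p(2) q(2) by (auto intro!: L2_inner_cong)
      moreover have "L2_inner (lebesgue_on K) u\<^sub>t v = L2_inner (lebesgue_on K) w\<^sub>h v"
        using post(3) arg_min K v_Ph by (simp add: l_def)
      ultimately have "?ip p v = ?ip q v"
        by (simp add: L2_inner_interior[OF conv])
      then show ?thesis
        using L2_inner_combine_left[OF poly_in_L2[OF v U(2,3)] poly_in_L2[OF p(1) U(2,3)]
            poly_in_L2[OF q(1) U(2,3)], of 1 "-1"]
        by (simp add: e_def)
    qed
    then have e: "e \<in> orth_poly n l ?U" "e \<in> orth_poly n (l + 1) ?U"
      using e_poly poly_fun_mono[OF e_poly, of "l + 1"] by (simp_all add: orth_poly_def)

    define r where "r = (\<lambda>y. \<tau> y - eps p y)"
    have \<tau>_U: "\<tau> \<in> L2 (lebesgue_on ?U)"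
      using dom(1) mesh_interior_subset[OF dom K]
      by (intro L2_lebesgue_on_subset[OF \<tau>]) (auto simp: polyhedral_domain_def)
    note p_L2 = eps_poly_in_L2[OF p(1) U(2,3)] and e_L2 = eps_poly_in_L2[OF e_poly U(2,3)]
    have r: "r \<in> L2 (lebesgue_on ?U)"
      using L2_combine[OF \<tau>_U p_L2, of 1 "-1"] by (simp add: r_def)
    have r_orth: "?ip r (eps e) = 0"
    proof -
      have "e \<in> restrictions K (I_minus_Ph_V fam k \<Omega> \<T> l)"
        using e(1) nl by (auto simp: restrictions_I_minus_Ph_V[OF dom K] n_def)
      then have "L2_inner (lebesgue_on K) (eps u\<^sub>t) (eps e) = L2_inner (lebesgue_on K) \<tau> (eps e)"
        using post(2) K by (simp add: l_def \<tau>_def)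
      moreover have "?ip (eps u\<^sub>t) (eps e) = ?ip (eps p) (eps e)"
        using eps_u by (auto intro!: L2_inner_cong)
      ultimately have "?ip (eps p) (eps e) = ?ip \<tau> (eps e)"
        by (simp add: L2_inner_interior[OF conv])
      then show ?thesis
        using L2_inner_combine_left[OF e_L2 \<tau>_U p_L2, of 1 "-1"] by (simp add: r_def)
    qed

    have "e x = 0"
    proof (rule ccontr)
      assume "e x \<noteq> 0"
      then have nz: "\<exists>y\<in>?U. e y \<noteq> 0" using x by blast
      let ?N = "dual_norm (orth_poly n (l + 1) ?U) ?U"
      have star: "star_norm fam k \<Omega> \<T> K s = ?N s'" if "\<And>y. y \<in> ?U \<Longrightarrow> s y = s' y" for s s'
        using star_norm_eq_dual_norm[OF dom K _ that] nl by (simp add: n_def l_def)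
      have star_u: "star_norm fam k \<Omega> \<T> K (\<lambda>y. compliance \<mu> lam (\<sigma>\<^sub>h y) - eps u\<^sub>t y) = ?N r"
        by (rule star) (simp add: r_def \<tau>_def eps_u)
      have star_w: "star_norm fam k \<Omega> \<T> K (\<lambda>y. compliance \<mu> lam (\<sigma>\<^sub>h y) - eps w\<^sub>h y)
          = ?N (\<lambda>y. r y + eps e y)"
        by (rule star) (simp add: r_def \<tau>_def eps_w eps_e)
      have "u\<^sub>t \<in> V_loc (post_degree fam k) K"
        using post(1) K by (simp add: V_pw_def)
      then have "(?N (\<lambda>y. r y + eps e y))\<^sup>2 \<le> (?N r)\<^sup>2"
        using arg_min post(3) K by (auto simp: star_u star_w not_less)
      moreover have "(?N r)\<^sup>2 < (?N (\<lambda>y. r y + eps e y))\<^sup>2"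
        using dual_norm_pythagoras[OF U n1 r e(2) nz r_orth] by linarith
      ultimately show False by simp
    qed
    then show ?thesis using p(2)[OF x] q(2)[OF x] by (simp add: e_def)
  qed
  with mesh_covers_AE[OF dom] show ?thesis
    by (auto elim!: eventually_mono)
qed

end
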